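(* Let $A_0,\dots,A_n\in\mathcal S^p$ be such that the system $\mathcal A(\mathbf x)\in\mathcal{COP}^p$, written equivalently as the linear semi-infinite system $(1,\mathbf x^\top)\mathbf a(\mathbf t)\ge 0$ for all $\mathbf t\in T$, is consistent, and let $T_{im}\ne\emptyset$. Let $G=\{\mathbf a(\mathbf t):\mathbf t\in T\}\cup\{(1,\mathbf 0_n^\top)^\top\}$ and define $$F=\{\mathbf b(k,j):k\in M(j),\ j\in J\},\qquad L=\mathrm{span}\,F,\qquad W=\mathrm{Pr}(\widetilde W,L^\perp),$$ $$\widetilde W=\{\mathbf a(\mathbf t):\mathbf t\in\Omega\}\cup\{\mathbf b(k,j):k\in N(j),\ j\in J\}\cup\{(1,\mathbf 0_n^\top)^\top\},$$ where $L^\perp$ is the orthogonal complement of $L$ in $\mathbb R^{n+1}$ and $\mathrm{Pr}(\widetilde W,L^\perp)$ is the orthogonal projection of the set $\widetilde W$ onto $L^\perp$. Then the system yields the uniform LP duality if and only if $\mathrm{cone}(G)=\mathrm{cone}(F\cup W)$ with $F$ and $W$ satisfying the following conditions: (a) $F$ is finite and $\mathrm{cone}(F)$ is a linear space which is also contained in $\mathrm{cone}(G)$; (b) $W$ is compact, and there exists a vector $\bar{\mathbf x}\in\mathbb R^n$ such that $s_0+\mathbf s^\top\bar{\mathbf x}=0$ for all $(s_0,\mathbf s^\top)^\top\in F$ and $t_0+\mathbf t^\top\bar{\mathbf x}>0$ for all $(t_0,\mathbf t^\top)^\top\in W$ (here $s_0,t_0\in\mathbb R$, $\mathbf s,\mathbf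 t\in\mathbb R^n$). Moreover, whenever $(s_0,\mathbf s^\top)^\top\in F$, the equality $\mathbf s^\top\mathbf x=-s_0$ is implied by the system $(1,\mathbf x^\top)\mathbf a(\mathbf t)\ge0$, $\mathbf t\in T$, and the equality $\mathbf s^\top\mathbf x=0$ is implied by the homogeneous system $(0,\mathbf x^\top)\mathbf a(\mathbf t)\ge 0$, $\mathbf t\in T$. Furthermore, $\mathbf s^\top\mathbf t+s_0t_0=0$ whenever $(s_0,\mathbf s^\top)^\top\in F$ and $(t_0,\mathbf t^\top)^\top\in W$.
   Context: Fix integers $p>1$, $n\ge 1$. $\mathcal S^p$ is the space of real symmetric $p\times p$ matrices with $A\bullet B=\mathrm{trace}(AB)$; $\mathbf e_1,\dots,\mathbf e_p$ is the standard basis of $\mathbb R^p$; $\mathbb R^p_+$ is the set of vectors with non-negative components; $P=\{1,\dots,p\}$; $T=\{\mathbf t\in\mathbb R^p_+:\sum_{k\in P} t_k=1\}$; $\mathcal{COP}^p=\{D\in\mathcal S^p:\mathbf t^\top D\mathbf t\ge 0\ \forall \mathbf t\in\mathbb R^p_+\}$; $\mathcal{CP}^p=\mathrm{conv}\{\mathbf t\mathbf t^\top:\mathbf t\in\mathbb R^p_+\}$. For a set $\mathcal B$, $\mathrm{cone}\,\mathcal B$ is the set of all finite linear combinations of elements of $\mathcal B$ with non-negative coefficients. Given $A_0,\dots,A_n\in\mathcal S^p$, put $\mathcal A(\mathbf x)=A_0+\sum_{m=1}^n x_mA_m$ for $\mathbf x\in\mathbb R^n$ and $X=\{\mathbf x\in\mathbb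 R^n:\mathcal A(\mathbf x)\in\mathcal{COP}^p\}$. The system is consistent if $X\ne\emptyset$. For $\mathbf c\in\mathbb R^n$ consider the primal problem (P): $\min \mathbf c^\top\mathbf x$ s.t. $\mathbf x\in X$, and its Lagrange dual (D): $\max\,(-U\bullet A_0)$ s.t. $U\bullet A_m=c_m$, $m=1,\dots,n$, $U\in\mathcal{CP}^p$; $Val(\cdot)$ denotes the optimal value. A consistent system yields the uniform LP duality if for every $\mathbf c\in\mathbb R^n$ with $Val(\mathrm P)>-\infty$ the dual (D) has an optimal solution and $Val(\mathrm P)=Val(\mathrm D)$. $T_{im}=\{\mathbf t\in T:\mathbf t^\top\mathcal A(\mathbf x)\mathbf t=0\ \forall\mathbf x\in X\}$ is the set of normalized immobile indices; when non-empty it is a finite union of convex bounded polyhedra. $\{\boldsymbol\tau(j):j\in J\}$, $|J|<\infty$, is the set of vertices of $\mathrm{conv}\,T_{im}$. For $j\in J$: $M(j)=\{k\in P:\mathbf e_k^\top\mathcal A(\mathbf x)\boldsymbol\tau(j)=0\ \forall\mathbf x\in X\}$, $N_*(j)=\{k\in P:\exists\,\mathbf x\in X \text{ with } \mathbf e_k^\top\mathcal A(\mathbf x)\boldsymbol\tau(j)=0\}$, $N(j)=N_*(j)\setminus M(j)$. Vectors in $\mathbb R^{n+1}$: $\mathbf a(\mathbf t)=(\mathbf t^\top A_m\mathbf t)_{m=0,\dots,n}$ for $\mathbf t\in T$, and $\mathbf b(k,j)=(\mathbf e_k^\top A_m\boldsymbol\tau(j))_{m=0,\dots,n}$ for $k\in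 P$, $j\in J$. $\Omega=\{\mathbf t\in T:\rho(\mathbf t,\mathrm{conv}\,T_{im})\ge\sigma\}$, where $\sigma=\min\{\tau_k(j):k\in P,\ \tau_k(j)>0,\ j\in J\}>0$ and $\rho(\mathbf t,\mathcal B)=\min_{\boldsymbol\tau\in\mathcal B}\sum_{k\in P}|t_k-\tau_k|$. *)

theory Defs
  imports "HOL-Analysis.Analysis"
begin

definition symmetric_matrices :: "(real^'p^'p) set" where
  "symmetric_matrices = {D. transpose D = D}"

definition mat_inner :: "real^'p^'p \<Rightarrow> real^'p^'p \<Rightarrow> real" (infixl "\<bullet>\<bullet>" 70) where
  "D \<bullet>\<bullet> E = trace (D ** E)"

definition nonneg_vectors :: "(real^'p) set" where
  "nonneg_vectors = {t. \<forall>k. 0 \<le> t $ k}"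

definition simplex_T :: "(real^'p) set" where
  "simplex_T = {t \<in> nonneg_vectors. (\<Sum>k\<in>UNIV. t $ k) = 1}"

definition copositive :: "(real^'p^'p) set" where
  "copositive = {D \<in> symmetric_matrices. \<forall>t\<in>nonneg_vectors. 0 \<le> t \<bullet> (D *v t)}"

definition rank_one :: "real^'p \<Rightarrow> real^'p^'p" where
  "rank_one t = (\<chi> i j. t $ i * t $ j)"

definition completely_positive :: "(real^'p^'p) set" where
  "completely_positive = convex hull (rank_one ` nonneg_vectors)"

text \<open>
  The library's \<open>cone\<close> and \<open>cone hull\<close> only close under scaling;
  \<open>fin_cone B\<close> is the set of finite non-negative linear combinations of elements of \<open>B\<close>
  (in particular it contains \<open>0\<close>).
\<close>

definition fin_cone :: "'v::real_vector set \<Rightarrow> 'v set" where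
  "fin_cone B = {(\<Sum>v\<in>S. c v *\<^sub>R v) | S c. finite S \<and> S \<subseteq> B \<and> (\<forall>v\<in>S. 0 \<le> c v)}"

text \<open>
  Orthogonal projection of the set \<open>B\<close> onto the subspace \<open>V\<close>: the points \<open>w \<in> V\<close> such that
  \<open>v - w\<close> is orthogonal to \<open>V\<close> for some \<open>v \<in> B\<close>.
\<close>

definition orth_projection :: "'v::euclidean_space set \<Rightarrow> 'v set \<Rightarrow> 'v set" where
  "orth_projection B V = {w \<in> V. \<exists>v\<in>B. v - w \<in> V\<^sup>\<bottom>}"

text \<open>
  Throughout, \<open>A0 :: real^'p^'p\<close> and \<open>A :: 'n \<Rightarrow> real^'p^'p\<close> are the coefficient matrices, and
  vectors \<open>(s\<^sub>0, s)\<close> of the (n+1)-dimensional space are pairs in \<open>real \<times> real^'n\<close>, whose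
  library inner product \<open>(s\<^sub>0, s) \<bullet> (t\<^sub>0, t) = s\<^sub>0 * t\<^sub>0 + s \<bullet> t\<close> is the standard one.
\<close>

definition pencil :: "real^'p^'p \<Rightarrow> ('n::finite \<Rightarrow> real^'p^'p) \<Rightarrow> real^'n \<Rightarrow> real^'p^'p" where
  "pencil A0 A x = A0 + (\<Sum>m\<in>UNIV. x $ m *\<^sub>R A m)"

definition feasible :: "real^'p^'p \<Rightarrow> ('n::finite \<Rightarrow> real^'p^'p) \<Rightarrow> (real^'n) set" where
  "feasible A0 A = {x. pencil A0 A x \<in> copositive}"

definition consistent :: "real^'p^'p \<Rightarrow> ('n::finite \<Rightarrow> real^'p^'p) \<Rightarrow> bool" where
  "consistent A0 A \<longleftrightarrow> feasible A0 A \<noteq> {}"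

definition dual_feasible :: "('n::finite \<Rightarrow> real^'p^'p) \<Rightarrow> real^'n \<Rightarrow> (real^'p^'p) set" where
  "dual_feasible A c = {U \<in> completely_positive. \<forall>m. U \<bullet>\<bullet> A m = c $ m}"

text \<open>Optimal values are extended reals.\<close>

definition val_P :: "real^'p^'p \<Rightarrow> ('n::finite \<Rightarrow> real^'p^'p) \<Rightarrow> real^'n \<Rightarrow> ereal" where
  "val_P A0 A c = (INF x\<in>feasible A0 A. ereal (c \<bullet> x))"

definition val_D :: "real^'p^'p \<Rightarrow> ('n::finite \<Rightarrow> real^'p^'p) \<Rightarrow> real^'n \<Rightarrow> ereal" where
  "val_D A0 A c = (SUP U\<in>dual_feasible A c. ereal (- (U \<bullet>\<bullet> A0)))"

definition dual_optimal ::
  "real^'p^'p \<Rightarrow> ('n::finite \<Rightarrow> real^'p^'p) \<Rightarrow> real^'n \<Rightarrow> real^'p^'p \<Rightarrow> bool" where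
  "dual_optimal A0 A c U \<longleftrightarrow> U \<in> dual_feasible A c \<and>
     (\<forall>V\<in>dual_feasible A c. - (V \<bullet>\<bullet> A0) \<le> - (U \<bullet>\<bullet> A0))"

definition uniform_LP_duality :: "real^'p^'p \<Rightarrow> ('n::finite \<Rightarrow> real^'p^'p) \<Rightarrow> bool" where
  "uniform_LP_duality A0 A \<longleftrightarrow>
     (\<forall>c. val_P A0 A c > - \<infinity> \<longrightarrow>
        (\<exists>U. dual_optimal A0 A c U) \<and> val_P A0 A c = val_D A0 A c)"

definition T_im :: "real^'p^'p \<Rightarrow> ('n::finite \<Rightarrow> real^'p^'p) \<Rightarrow> (real^'p) set" where
  "T_im A0 A = {t \<in> simplex_T. \<forall>x\<in>feasible A0 A. t \<bullet> (pencil A0 A x *v t) = 0}"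

text \<open>
  The vertices of the convex hull of the immobile indices serve as their own index set:
  below, \<open>\<tau>\<close> ranges over \<open>vertices_im A0 A\<close> in place of an index \<open>j \<in> J\<close>.
\<close>

definition vertices_im :: "real^'p^'p \<Rightarrow> ('n::finite \<Rightarrow> real^'p^'p) \<Rightarrow> (real^'p) set" where
  "vertices_im A0 A = {\<tau>. \<tau> extreme_point_of (convex hull (T_im A0 A))}"

definition M_set :: "real^'p^'p \<Rightarrow> ('n::finite \<Rightarrow> real^'p^'p) \<Rightarrow> real^'p \<Rightarrow> 'p set" where
  "M_set A0 A \<tau> = {k. \<forall>x\<in>feasible A0 A. axis k 1 \<bullet> (pencil A0 A x *v \<tau>) = 0}"

definition N_star :: "real^'p^'p \<Rightarrow> ('n::finite \<Rightarrow> real^'p^'p) \<Rightarrow> real^'p \<Rightarrow> 'p set" where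
  "N_star A0 A \<tau> = {k. \<exists>x\<in>feasible A0 A. axis k 1 \<bullet> (pencil A0 A x *v \<tau>) = 0}"

definition N_set :: "real^'p^'p \<Rightarrow> ('n::finite \<Rightarrow> real^'p^'p) \<Rightarrow> real^'p \<Rightarrow> 'p set" where
  "N_set A0 A \<tau> = N_star A0 A \<tau> - M_set A0 A \<tau>"

definition a_vec ::
  "real^'p^'p \<Rightarrow> ('n::finite \<Rightarrow> real^'p^'p) \<Rightarrow> real^'p \<Rightarrow> real \<times> (real^'n)" where
  "a_vec A0 A t = (t \<bullet> (A0 *v t), \<chi> m. t \<bullet> (A m *v t))"

definition b_vec ::
  "real^'p^'p \<Rightarrow> ('n::finite \<Rightarrow> real^'p^'p) \<Rightarrow> 'p \<Rightarrow> real^'p \<Rightarrow> real \<times> (real^'n)" where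
  "b_vec A0 A k \<tau> = (axis k 1 \<bullet> (A0 *v \<tau>), \<chi> m. axis k 1 \<bullet> (A m *v \<tau>))"

definition rho :: "real^'p \<Rightarrow> (real^'p) set \<Rightarrow> real" where
  "rho t B = (INF \<tau>\<in>B. \<Sum>k\<in>UNIV. \<bar>t $ k - \<tau> $ k\<bar>)"

definition sigma :: "real^'p^'p \<Rightarrow> ('n::finite \<Rightarrow> real^'p^'p) \<Rightarrow> real" where
  "sigma A0 A = Min {\<tau> $ k | \<tau> k. \<tau> \<in> vertices_im A0 A \<and> \<tau> $ k > 0}"

definition Omega :: "real^'p^'p \<Rightarrow> ('n::finite \<Rightarrow> real^'p^'p) \<Rightarrow> (real^'p) set" where
  "Omega A0 A = {t \<in> simplex_T. rho t (convex hull (T_im A0 A)) \<ge> sigma A0 A}"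

definition G_set :: "real^'p^'p \<Rightarrow> ('n::finite \<Rightarrow> real^'p^'p) \<Rightarrow> (real \<times> (real^'n)) set" where
  "G_set A0 A = a_vec A0 A ` simplex_T \<union> {(1, 0)}"

definition F_set :: "real^'p^'p \<Rightarrow> ('n::finite \<Rightarrow> real^'p^'p) \<Rightarrow> (real \<times> (real^'n)) set" where
  "F_set A0 A = {b_vec A0 A k \<tau> | k \<tau>. \<tau> \<in> vertices_im A0 A \<and> k \<in> M_set A0 A \<tau>}"

definition W_tilde :: "real^'p^'p \<Rightarrow> ('n::finite \<Rightarrow> real^'p^'p) \<Rightarrow> (real \<times> (real^'n)) set" where
  "W_tilde A0 A = a_vec A0 A ` Omega A0 A
     \<union> {b_vec A0 A k \<tau> | k \<tau>. \<tau> \<in> vertices_im A0 A \<and> k \<in> N_set A0 A \<tau>}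
     \<union> {(1, 0)}"

definition W_set :: "real^'p^'p \<Rightarrow> ('n::finite \<Rightarrow> real^'p^'p) \<Rightarrow> (real \<times> (real^'n)) set" where
  "W_set A0 A = orth_projection (W_tilde A0 A) ((span (F_set A0 A))\<^sup>\<bottom>)"

end

theory Submission
  imports Defs
begin

text \<open>
  Two facts carry the theorem. The first is linear duality: writing \<open>K\<close> for the cone generated by
  \<open>G\<close>, the moments of completely positive matrices are exactly the elements of the cone of the
  \<open>a(t)\<close>, so an optimal dual solution without duality gap is a representation of a valid affine
  inequality \<open>s\<^sub>0 + s \<bullet> x \<ge> 0\<close> on the feasible set \<open>X\<close> as an element of \<open>K\<close>. Hence uniform
  duality says that \<open>K\<close> contains every inequality valid on \<open>X\<close>, which holds as soon as \<open>K\<close> is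
  closed. Closedness is what (a) and (b) give: \<open>F\<close> generates a subspace, \<open>W\<close> is a compact set
  orthogonal to it, and the functional \<open>(1, xbar)\<close> is positive on \<open>W\<close>, so that \<open>W\<close> generates a
  closed cone and adding the orthogonal subspace keeps it closed.

  The second fact is that the equations given by \<open>F\<close> and the inequalities given by \<open>W\<close> describe
  \<open>X\<close>, whether or not duality holds. Take a relative interior point \<open>x\<close> of \<open>X\<close>. A valid
  inequality that is tight at \<open>x\<close> is tight on all of \<open>X\<close>; therefore \<open>(1, x)\<close> is positive on
  \<open>W\<close>, while it vanishes on \<open>F\<close>, and only immobile indices can occur with positive weight in an
  element of \<open>K\<close> that vanishes at \<open>x\<close>. For immobile \<open>t\<close> the vector \<open>a(t)\<close> is in the cone of
  \<open>F\<close> (\<open>a_vec_immobile_in_cone_F\<close>). Under duality \<open>-f\<close> is in \<open>K\<close> for each \<open>f\<close> in \<open>F\<close>,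
  hence in the cone of \<open>F\<close>, so that this cone is a subspace.

  To see that \<open>F\<close> and \<open>W\<close> imply the whole system, one tests copositivity of
  \<open>D = \<A>(x)\<close> as follows: if \<open>D \<tau> \<ge> 0\<close> for each vertex \<open>\<tau>\<close>, then subtracting from \<open>t \<ge> 0\<close> the
  largest possible multiple of a vertex supported inside the support of \<open>t\<close> does not increase the
  form. After finitely many steps no support of a vertex is contained in the support of what is
  left; if this is not zero, then after normalization it has \<open>l\<^sub>1\<close>-distance at least \<open>\<sigma>\<close> from
  the hull of the immobile indices, so it is
  in \<open>\<Omega>\<close> (\<open>copositivity_test_on_Omega_and_vertices\<close>). The conditions
  \<open>(D \<tau>)\<^sub>k \<ge> 0\<close> with \<open>k\<close> outside \<open>N\<^sub>*\<close> are never active on \<open>X\<close>, so they can be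
  dropped by convexity (\<open>feasible_if_reduced_system\<close>). Since the cone of \<open>F \<union> W\<close> is
  closed, equality of the polars gives equality of the cones (\<open>cone_F_W_eq_cone_G\<close>).

  The vertices are finitely many because two of them cannot have the same support
  (\<open>vertex_support_minimal\<close>); this makes \<open>\<sigma>\<close> a genuine positive minimum and \<open>F\<close> finite.
\<close>

section \<open>Finitely generated cones, projections and closedness\<close>

lemma fin_cone_eq_convex_cone_hull: "fin_cone B = convex_cone hull B"
proof
  show "fin_cone B \<subseteq> convex_cone hull B"
  proof
    fix x assume "x \<in> fin_cone B"
    then obtain S c where S: "finite S" "S \<subseteq> B" "\<forall>v\<in>S. 0 \<le> c v"
      and x: "x = (\<Sum>v\<in>S. c v *\<^sub>R v)"
      by (auto simp: fin_cone_def)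
    have "(\<Sum>v\<in>S. c v *\<^sub>R v) \<in> convex_cone hull B"
      using S
      by (induction S rule: finite_induct)
         (auto intro: convex_cone_hull_add convex_cone_hull_mul convex_cone_hull_contains_0 hull_inc)
    then show "x \<in> convex_cone hull B" by (simp add: x)
  qed
  have "convex_cone (fin_cone B)"
    unfolding convex_cone_iff
  proof (intro conjI ballI allI impI)
    show "0 \<in> fin_cone B"
      unfolding fin_cone_def by (force intro: exI[of _ "{}"])
  next
    fix x y assume "x \<in> fin_cone B" "y \<in> fin_cone B"
    then obtain S c S' c' where S: "finite S" "S \<subseteq> B" "\<forall>v\<in>S. 0 \<le> c v"
      and x: "x = (\<Sum>v\<in>S. c v *\<^sub>R v)"
      and S': "finite S'" "S' \<subseteq> B" "\<forall>v\<in>S'. 0 \<le> c' v"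
      and y: "y = (\<Sum>v\<in>S'. c' v *\<^sub>R v)"
      unfolding fin_cone_def by blast
    define d where "d v = (if v \<in> S then c v else 0) + (if v \<in> S' then c' v else 0)" for v
    have "x = (\<Sum>v\<in>S \<union> S'. (if v \<in> S then c v else 0) *\<^sub>R v)"
      unfolding x using S S' by (intro sum.mono_neutral_cong_left) auto
    moreover have "y = (\<Sum>v\<in>S \<union> S'. (if v \<in> S' then c' v else 0) *\<^sub>R v)"
      unfolding y using S S' by (intro sum.mono_neutral_cong_left) auto
    ultimately have "x + y = (\<Sum>v\<in>S \<union> S'. d v *\<^sub>R v)"
      by (simp add: d_def scaleR_add_left sum.distrib)
    moreover have "\<forall>v\<in>S \<union> S'. 0 \<le> d v" using S S' by (auto simp: d_def)
    ultimately show "x + y \<in> fin_cone B"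
      unfolding fin_cone_def using S S' by (auto intro!: exI[of _ "S \<union> S'"] exI[of _ d])
  next
    fix x and r :: real assume "x \<in> fin_cone B" "0 \<le> r"
    then obtain S c where S: "finite S" "S \<subseteq> B" "\<forall>v\<in>S. 0 \<le> c v"
      and x: "x = (\<Sum>v\<in>S. c v *\<^sub>R v)"
      by (auto simp: fin_cone_def)
    have "r *\<^sub>R x = (\<Sum>v\<in>S. (r * c v) *\<^sub>R v)" by (simp add: x scaleR_sum_right)
    then show "r *\<^sub>R x \<in> fin_cone B"
      unfolding fin_cone_def using S \<open>0 \<le> r\<close>
      by (auto intro!: exI[of _ S] exI[of _ "\<lambda>v. r * c v"])
  qed
  moreover have "B \<subseteq> fin_cone B"
  proof
    fix b assume "b \<in> B"
    then show "b \<in> fin_cone B"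
      unfolding fin_cone_def by (auto intro!: exI[of _ "{b}"] exI[of _ "\<lambda>_. 1"])
  qed
  ultimately show "convex_cone hull B \<subseteq> fin_cone B"
    by (rule hull_minimal[rotated])
qed

lemma convex_cone_fin_cone: "convex_cone (fin_cone B)"
  by (simp add: fin_cone_eq_convex_cone_hull convex_cone_convex_cone_hull)

lemma fin_cone_inc: "b \<in> B \<Longrightarrow> b \<in> fin_cone B"
  by (simp add: fin_cone_eq_convex_cone_hull hull_inc)

lemma fin_cone_minimal: "B \<subseteq> S \<Longrightarrow> convex_cone S \<Longrightarrow> fin_cone B \<subseteq> S"
  by (simp add: fin_cone_eq_convex_cone_hull hull_minimal)

lemma fin_cone_mono: "B \<subseteq> C \<Longrightarrow> fin_cone B \<subseteq> fin_cone C"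
  by (simp add: fin_cone_eq_convex_cone_hull hull_mono)

lemma fin_cone_Un:
  "fin_cone (S \<union> T) = {x + y | x y. x \<in> fin_cone S \<and> y \<in> fin_cone T}"
  by (auto simp: fin_cone_eq_convex_cone_hull convex_cone_hull_Un)

lemma convex_cone_sum:
  assumes "convex_cone S" "\<And>i. i \<in> I \<Longrightarrow> f i \<in> S"
  shows "sum f I \<in> S"
  using assms(2)
  by (induction I rule: infinite_finite_induct)
     (auto intro: convex_cone_add[OF assms(1)] convex_cone_contains_0[OF assms(1)])

text \<open>
  The bipolar theorem: a point outside a closed cone is separated from it by a functional that, by
  homogeneity, is nonnegative on the generators.
\<close>

lemma mem_fin_cone_of_polar:
  fixes B :: "'a::euclidean_space set"
  assumes closed: "closed (fin_cone B)"
    and polar: "\<And>y. \<forall>b\<in>B. 0 \<le> y \<bullet> b \<Longrightarrow> 0 \<le> y \<bullet> z"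
  shows "z \<in> fin_cone B"
proof (rule ccontr)
  assume "z \<notin> fin_cone B"
  then obtain y r where y: "y \<bullet> z < r" "\<forall>x\<in>fin_cone B. r < y \<bullet> x"
    using separating_hyperplane_closed_point[of "fin_cone B" z] closed
      convex_cone_fin_cone[of B] unfolding convex_cone_def by blast
  have "r < 0" using y(2) convex_cone_contains_0[OF convex_cone_fin_cone[of B]] by force
  have "0 \<le> y \<bullet> b" if "b \<in> B" for b
  proof (rule ccontr)
    assume neg: "\<not> 0 \<le> y \<bullet> b"
    \<comment> \<open>the multiple of \<open>b\<close> on which \<open>y\<close> takes exactly the forbidden value \<open>r\<close>\<close>
    define k where "k = r / (y \<bullet> b)"
    have "0 \<le> k" using neg \<open>r < 0\<close> by (simp add: k_def divide_nonpos_neg)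
    then have "k *\<^sub>R b \<in> fin_cone B"
      using that by (intro convex_cone_scaleR convex_cone_fin_cone fin_cone_inc)
    then have "r < y \<bullet> (k *\<^sub>R b)" using y(2) by blast
    then show False using neg by (simp add: k_def)
  qed
  then have "0 \<le> y \<bullet> z" using polar by blast
  then show False using y(1) \<open>r < 0\<close> by linarith
qed

text \<open>
  Consequences of an inhomogeneous system \<open>(1, v) \<bullet> s \<ge> 0\<close> carry over to its conic closure, where
  the leading coordinate of \<open>y\<close> may vanish (recession directions): for every small \<open>e > 0\<close> the vector
  \<open>y + e (1, x)\<close> has a positive leading coordinate, so rescaling it gives a solution of the system.
\<close>

lemma nonneg_by_homogenization:
  fixes S :: "(real \<times> 'a::euclidean_space) set"
  assumes e0: "(1, 0) \<in> S"
    and x: "\<forall>s\<in>S. 0 \<le> (1, x) \<bullet> s"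
    and implied: "\<And>v. \<forall>s\<in>S. 0 \<le> (1, v) \<bullet> s \<Longrightarrow> 0 \<le> (1, v) \<bullet> z"
    and y: "\<forall>s\<in>S. 0 \<le> y \<bullet> s"
  shows "0 \<le> y \<bullet> z"
proof (rule field_le_epsilon)
  fix d :: real assume d: "d > 0"
  have den: "1 + (1, x) \<bullet> z > 0" using implied[OF x] by linarith
  \<comment> \<open>small enough for \<open>e (1, x)\<close> to change the value at \<open>z\<close> by at most \<open>d\<close>\<close>
  define e where "e = d / (1 + (1, x) \<bullet> z)"
  have e: "e > 0" using d den by (simp add: e_def)
  have "0 \<le> y \<bullet> (1, 0)" using y e0 by blast
  then have y0: "0 \<le> fst y" by (simp add: inner_prod_def)
  define u where "u = fst y + e"
  have u: "u > 0" using y0 e by (simp add: u_def)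
  define v where "v = (1 / u) *\<^sub>R (snd y + e *\<^sub>R x)"
  have "u *\<^sub>R (1, v) = y + e *\<^sub>R (1, x)"
    using u by (simp add: v_def prod_eq_iff) (simp add: u_def)
  then have "(u *\<^sub>R (1, v)) \<bullet> b = (y + e *\<^sub>R (1, x)) \<bullet> b" for b by simp
  then have v: "u * ((1, v) \<bullet> b) = y \<bullet> b + e * ((1, x) \<bullet> b)" for b
    by (simp only: inner_add_left inner_scaleR_left)
  have "0 \<le> (1, v) \<bullet> s" if "s \<in> S" for s
  proof -
    have "0 \<le> u * ((1, v) \<bullet> s)" unfolding v using that e x y by simp
    then show ?thesis using u by (simp add: zero_le_mult_iff)
  qed
  then have "0 \<le> u * ((1, v) \<bullet> z)" using implied u by simp
  then have "0 \<le> y \<bullet> z + e * ((1, x) \<bullet> z)" unfolding v .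
  moreover have "e * ((1, x) \<bullet> z) \<le> e * (1 + (1, x) \<bullet> z)"
    using e by (intro mult_left_mono) auto
  moreover have "e * (1 + (1, x) \<bullet> z) = d" using den by (simp add: e_def)
  ultimately show "0 \<le> y \<bullet> z + d" by linarith
qed

text \<open>
  Positivity of one functional keeps the compact convex hull of \<open>W\<close> away from the origin, and the rays
  through a compact set that avoids the origin form a closed set.
\<close>

lemma closed_fin_cone_compact:
  fixes W :: "'a::euclidean_space set"
  assumes "compact W" and pos: "\<forall>w\<in>W. 0 < y \<bullet> w"
  shows "closed (fin_cone W)"
proof (cases "W = {}")
  case True
  then show ?thesis by (simp add: fin_cone_eq_convex_cone_hull)
next
  case False
  have "convex {w. y \<bullet> w > 0}" by (rule convex_halfspace_gt)
  then have "convex hull W \<subseteq> {w. y \<bullet> w > 0}"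
    using pos by (intro hull_minimal) auto
  then have "0 \<notin> convex hull W" by auto
  moreover have "compact (convex hull W)" by (simp add: assms compact_convex_hull)
  ultimately show ?thesis
    using False closed_conic_hull[of "convex hull W"]
    by (simp add: fin_cone_eq_convex_cone_hull convex_cone_hull_separate_nonempty)
qed

lemma orth_projector:
  fixes V :: "'a::euclidean_space set"
  assumes V: "subspace V"
  obtains p where "linear p" "\<And>v. p v \<in> V" "\<And>v. v - p v \<in> V\<^sup>\<bottom>"
    "\<And>v. v \<in> V \<Longrightarrow> p v = v" "\<And>v. v \<in> V\<^sup>\<bottom> \<Longrightarrow> p v = 0"
    "\<And>B. orth_projection B V = p ` B"
proof -
  have "\<exists>w. w \<in> V \<and> v - w \<in> V\<^sup>\<bottom>" for v
  proof -
    have "v \<in> V + V\<^sup>\<bottom>" by (simp add: subspace_sum_orthogonal_comp[OF V])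
    then obtain w u where "v = w + u" "w \<in> V" "u \<in> V\<^sup>\<bottom>" by (rule set_plus_elim)
    then show ?thesis by (intro exI[of _ w]) auto
  qed
  then obtain p where p: "\<And>v. p v \<in> V" "\<And>v. v - p v \<in> V\<^sup>\<bottom>" by metis
  have unique: "w = p v" if "w \<in> V" "v - w \<in> V\<^sup>\<bottom>" for v w
  proof -
    have "w - p v \<in> V" using that p V by (intro subspace_diff) auto
    moreover have "(v - p v) - (v - w) \<in> V\<^sup>\<bottom>"
      using that p by (blast intro: subspace_diff subspace_orthogonal_comp)
    ultimately have "w - p v \<in> V \<inter> V\<^sup>\<bottom>" by simp
    then show ?thesis using orthogonal_Int_0[OF V] by auto
  qed
  have "linear p"
  proof (rule linearI)
    fix u v
    have "(u - p u) + (v - p v) \<in> V\<^sup>\<bottom>"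
      using p by (intro subspace_add subspace_orthogonal_comp) auto
    then have "(u + v) - (p u + p v) \<in> V\<^sup>\<bottom>" by (simp add: algebra_simps)
    moreover have "p u + p v \<in> V" using p V by (intro subspace_add) auto
    ultimately show "p (u + v) = p u + p v" using unique by metis
  next
    fix r v
    have "r *\<^sub>R (v - p v) \<in> V\<^sup>\<bottom>"
      using p by (intro subspace_scale subspace_orthogonal_comp) auto
    then have "r *\<^sub>R v - r *\<^sub>R p v \<in> V\<^sup>\<bottom>" by (simp add: algebra_simps)
    moreover have "r *\<^sub>R p v \<in> V" using p V by (intro subspace_scale) auto
    ultimately show "p (r *\<^sub>R v) = r *\<^sub>R p v" using unique by metis
  qed
  moreover have "p v = v" if "v \<in> V" for v
    using unique[of v v, symmetric] that subspace_0[OF subspace_orthogonal_comp, of V] by simp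
  moreover have "p v = 0" if "v \<in> V\<^sup>\<bottom>" for v
    using unique[of 0 v] that subspace_0[OF V] by simp
  moreover have "orth_projection B V = p ` B" for B
    unfolding orth_projection_def using p unique by blast
  ultimately show thesis using that p by blast
qed

lemma fin_cone_eq_span:
  assumes "subspace (fin_cone F)"
  shows "fin_cone F = span F"
proof
  show "fin_cone F \<subseteq> span F"
    by (rule fin_cone_minimal)
       (auto simp: convex_cone_iff span_add span_scale span_zero span_base)
  show "span F \<subseteq> fin_cone F"
    by (rule span_minimal[OF _ assms]) (auto intro: fin_cone_inc)
qed

text \<open>
  A sum of two closed cones need not be closed. Here one summand is a subspace and the other lies in
  its orthogonal complement, so the sum is the preimage of the second cone under a projection.
\<close>

lemma closed_fin_cone_subspace_Un_orthogonal:
  fixes F W :: "'a::euclidean_space set"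
  assumes F: "subspace (fin_cone F)" and W: "closed (fin_cone W)" "W \<subseteq> (span F)\<^sup>\<bottom>"
  shows "closed (fin_cone (F \<union> W))"
proof -
  let ?V = "(span F)\<^sup>\<bottom>"
  obtain p where lin: "linear p" and p: "\<And>v. p v \<in> ?V" "\<And>v. v - p v \<in> ?V\<^sup>\<bottom>"
    "\<And>v. v \<in> ?V \<Longrightarrow> p v = v" "\<And>v. v \<in> ?V\<^sup>\<bottom> \<Longrightarrow> p v = 0"
    using orth_projector[OF subspace_orthogonal_comp] by metis
  have V: "?V\<^sup>\<bottom> = span F" by (simp add: orthogonal_comp_self)
  have coneF: "fin_cone F = span F" by (rule fin_cone_eq_span[OF F])
  have coneW: "fin_cone W \<subseteq> ?V"
  proof (rule fin_cone_minimal[OF W(2)])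
    show "convex_cone ?V"
      using subspace_orthogonal_comp[of "span F"]
      by (auto simp: convex_cone_iff subspace_def)
  qed
  have "fin_cone (F \<union> W) = p -` fin_cone W"
  proof (rule set_eqI)
    fix z
    show "z \<in> fin_cone (F \<union> W) \<longleftrightarrow> z \<in> p -` fin_cone W"
    proof
      assume "z \<in> fin_cone (F \<union> W)"
      then obtain x y where z: "z = x + y" "x \<in> span F" "y \<in> fin_cone W"
        unfolding fin_cone_Un coneF by blast
      then have "p z = y" using p coneW V linear_add[OF lin] by auto
      then show "z \<in> p -` fin_cone W" using z by simp
    next
      assume "z \<in> p -` fin_cone W"
      moreover have "z = (z - p z) + p z" "z - p z \<in> fin_cone F" using p(2) V coneF by auto
      ultimately show "z \<in> fin_cone (F \<union> W)" unfolding fin_cone_Un by blast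
    qed
  qed
  moreover have "closed (p -` fin_cone W)"
    using W lin linear_continuous_on linear_conv_bounded_linear
    by (intro closed_vimage) auto
  ultimately show ?thesis by simp
qed

section \<open>Bilinear coefficient vectors\<close>

text \<open>
  Polarization of \<open>a(t)\<close>: both \<open>a(t)\<close> and \<open>b(k, j)\<close> are values of one bilinear map, which allows
  expansions of \<open>a(t)\<close> along a decomposition of \<open>t\<close>.
\<close>

definition coeff_vec ::
  "real^'p^'p \<Rightarrow> ('n::finite \<Rightarrow> real^'p^'p) \<Rightarrow> real^'p \<Rightarrow> real^'p \<Rightarrow> real \<times> (real^'n)" where
  "coeff_vec A0 A u w = (u \<bullet> (A0 *v w), \<chi> m. u \<bullet> (A m *v w))"

lemma a_vec_eq_coeff_vec: "a_vec A0 A t = coeff_vec A0 A t t"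
  by (simp add: a_vec_def coeff_vec_def)

lemma b_vec_eq_coeff_vec: "b_vec A0 A k \<tau> = coeff_vec A0 A (axis k 1) \<tau>"
  by (simp add: b_vec_def coeff_vec_def)

lemma linear_coeff_vec_left: "linear (\<lambda>u. coeff_vec A0 A u w)"
  by (rule linearI) (auto simp: coeff_vec_def vec_eq_iff inner_add_left)

lemma linear_coeff_vec_right: "linear (\<lambda>w. coeff_vec A0 A u w)"
  by (rule linearI)
     (auto simp: coeff_vec_def vec_eq_iff matrix_vector_right_distrib inner_add_right
        matrix_vector_mult_scaleR)

lemma cart_eq_sum_axis: "(u::real^'p) = (\<Sum>k\<in>UNIV. u $ k *\<^sub>R axis k 1)"
  using basis_expansion[of u] by (simp add: scalar_mult_eq_scaleR)

lemma coeff_vec_eq_sum_b_vec: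
  "coeff_vec A0 A u w = (\<Sum>k\<in>UNIV. u $ k *\<^sub>R b_vec A0 A k w)"
proof -
  have "coeff_vec A0 A u w = coeff_vec A0 A (\<Sum>k\<in>UNIV. u $ k *\<^sub>R axis k 1) w"
    by (subst cart_eq_sum_axis) simp
  also have "\<dots> = (\<Sum>k\<in>UNIV. u $ k *\<^sub>R b_vec A0 A k w)"
    by (simp add: linear_sum[OF linear_coeff_vec_left] linear_scale[OF linear_coeff_vec_left]
        b_vec_eq_coeff_vec)
  finally show ?thesis .
qed

lemma inner_coeff_vec: "(1, x) \<bullet> coeff_vec A0 A u w = u \<bullet> (pencil A0 A x *v w)"
proof -
  have "(\<Sum>m\<in>I. x $ m *\<^sub>R A m) *v w = (\<Sum>m\<in>I. x $ m *\<^sub>R (A m *v w))" if "finite I" for I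
    using that
    by (induction I rule: finite_induct)
       (auto simp: matrix_vector_mult_add_rdistrib scaleR_matrix_vector_assoc)
  then show ?thesis
    by (simp add: coeff_vec_def pencil_def matrix_vector_mult_add_rdistrib inner_add_right
        inner_sum_right inner_vec_def[of x])
qed

lemma symmetric_pencil:
  assumes "A0 \<in> symmetric_matrices" "\<And>m. A m \<in> symmetric_matrices"
  shows "pencil A0 A x \<in> symmetric_matrices"
  using assms
  by (auto simp: pencil_def symmetric_matrices_def transpose_def vec_eq_iff)

section \<open>Copositive forms\<close>

lemma symmetric_inner_commute:
  assumes "D \<in> symmetric_matrices"
  shows "u \<bullet> (D *v w) = w \<bullet> (D *v u)"
  using assms
  by (metis (mono_tags, lifting) dot_lmul_matrix inner_commute mem_Collect_eq
      symmetric_matrices_def transpose_matrix_vector)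

lemma quadratic_form_add:
  assumes "D \<in> symmetric_matrices"
  shows "(u + r *\<^sub>R w) \<bullet> (D *v (u + r *\<^sub>R w))
       = u \<bullet> (D *v u) + 2 * r * (u \<bullet> (D *v w)) + r\<^sup>2 * (w \<bullet> (D *v w))"
  using symmetric_inner_commute[OF assms, of u w]
  by (simp add: matrix_vector_right_distrib matrix_vector_mult_scaleR inner_add_left
      inner_add_right power2_eq_square algebra_simps)

text \<open>
  A zero of a copositive form minimizes it over the orthant, so directional derivatives into the
  orthant are nonnegative.
\<close>

lemma copositive_gradient_nonneg:
  assumes D: "D \<in> copositive" and \<tau>: "\<tau> \<in> nonneg_vectors" "\<tau> \<bullet> (D *v \<tau>) = 0"
    and u: "u \<in> nonneg_vectors"
  shows "0 \<le> u \<bullet> (D *v \<tau>)"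
proof (rule ccontr)
  assume neg: "\<not> ?thesis"
  define q where "q = u \<bullet> (D *v \<tau>)"
  define r where "r = u \<bullet> (D *v u)"
  have Dsym: "D \<in> symmetric_matrices" and r: "0 \<le> r"
    using D u by (auto simp: copositive_def r_def)
  \<comment> \<open>a step so short that the negative linear term dominates\<close>
  define e where "e = - q / (r + 1)"
  have e: "e > 0" using neg r by (simp add: e_def q_def divide_neg_pos)
  have "\<tau> + e *\<^sub>R u \<in> nonneg_vectors"
    using \<tau> u e by (auto simp: nonneg_vectors_def)
  then have "0 \<le> (\<tau> + e *\<^sub>R u) \<bullet> (D *v (\<tau> + e *\<^sub>R u))"
    using D by (auto simp: copositive_def)
  also have "\<dots> = e * (2 * q + e * r)"
    using \<tau>(2) symmetric_inner_commute[OF Dsym, of \<tau> u]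
    by (simp add: quadratic_form_add[OF Dsym] q_def r_def power2_eq_square algebra_simps)
  finally have "0 \<le> 2 * q + e * r" using e by (simp add: zero_le_mult_iff)
  moreover have "e * (r + 1) = - q" using r by (simp add: e_def)
  ultimately show False using neg e by (simp add: q_def algebra_simps)
qed

text \<open>
  Complementary slackness: the nonnegative numbers \<open>\<tau>\<^sub>k (D \<tau>)\<^sub>k\<close> sum to zero.
\<close>

lemma copositive_gradient_zero_on_support:
  assumes D: "D \<in> copositive" and \<tau>: "\<tau> \<in> nonneg_vectors" "\<tau> \<bullet> (D *v \<tau>) = 0"
    and k: "\<tau> $ k > 0"
  shows "axis k 1 \<bullet> (D *v \<tau>) = 0"
proof -
  have nn: "0 \<le> (D *v \<tau>) $ i" for i
  proof -
    have "axis i 1 \<in> nonneg_vectors" by (simp add: nonneg_vectors_def axis_def)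
    then show ?thesis
      using copositive_gradient_nonneg[OF D \<tau>, of "axis i 1"] by (simp add: inner_axis')
  qed
  have "(\<Sum>i\<in>UNIV. \<tau> $ i * (D *v \<tau>) $ i) = 0" using \<tau>(2) by (simp add: inner_vec_def)
  moreover have "0 \<le> \<tau> $ i * (D *v \<tau>) $ i" for i using nn \<tau> by (simp add: nonneg_vectors_def)
  ultimately have "\<tau> $ k * (D *v \<tau>) $ k = 0" by (simp add: sum_nonneg_eq_0_iff)
  then show ?thesis using k by (simp add: inner_axis')
qed

lemma coordinatewise_nonneg_inner:
  assumes "u \<in> nonneg_vectors" "\<And>k. 0 \<le> axis k 1 \<bullet> (w::real^'p)"
  shows "0 \<le> u \<bullet> w"
  using assms by (auto simp: inner_vec_def[of u] nonneg_vectors_def inner_axis' intro!: sum_nonneg)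

section \<open>The simplex and the completely positive cone\<close>

lemma normalize_in_simplex:
  assumes "t \<in> nonneg_vectors" "t \<noteq> 0"
  obtains r s where "r > 0" "s \<in> simplex_T" "t = r *\<^sub>R s"
proof -
  define r where "r = (\<Sum>k\<in>UNIV. t $ k)"
  have "0 \<le> t $ k" for k using assms by (simp add: nonneg_vectors_def)
  then have "r > 0"
    using assms(2) by (auto simp: r_def less_le sum_nonneg sum_nonneg_eq_0_iff vec_eq_iff)
  moreover have "(1 / r) *\<^sub>R t \<in> simplex_T"
    using assms \<open>r > 0\<close>
    by (auto simp: simplex_T_def nonneg_vectors_def r_def simp flip: sum_divide_distrib)
  ultimately show thesis using that[of r "(1 / r) *\<^sub>R t"] by simp
qed

lemma finite_pos_lower_bound:
  fixes f :: "'i::finite \<Rightarrow> real"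
  obtains e where "e > 0" "\<And>k. f k > 0 \<Longrightarrow> e \<le> f k"
proof -
  define e where "e = Min (insert 1 {f k | k. f k > 0})"
  have fin: "finite (insert 1 {f k | k. f k > 0})" by simp
  have "e > 0" unfolding e_def using fin by (subst Min_gr_iff) auto
  moreover have "e \<le> f k" if "f k > 0" for k
    unfolding e_def using that by (intro Min_le[OF fin]) auto
  ultimately show thesis using that by blast
qed

lemma compact_simplex_T: "compact (simplex_T :: (real^'p) set)"
proof -
  have "simplex_T = (\<Inter>k. {t. 0 \<le> t $ k}) \<inter> {t::real^'p. (\<Sum>k\<in>UNIV. t $ k) = 1}"
    by (auto simp: simplex_T_def nonneg_vectors_def)
  moreover have "closed \<dots>"
    by (intro closed_Int closed_INT ballI closed_Collect_le closed_Collect_eq continuous_intros)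
  moreover have "bounded (simplex_T :: (real^'p) set)"
  proof (rule boundedI)
    fix t :: "real^'p" assume "t \<in> simplex_T"
    then have "(\<Sum>k\<in>UNIV. \<bar>t $ k\<bar>) = 1" by (simp add: simplex_T_def nonneg_vectors_def)
    then show "norm t \<le> 1" using norm_le_l1_cart[of t] by simp
  qed
  ultimately show ?thesis by (simp add: compact_eq_bounded_closed)
qed

lemma a_vec_scaleR: "a_vec A0 A (r *\<^sub>R t) = r\<^sup>2 *\<^sub>R a_vec A0 A t"
  by (simp add: a_vec_eq_coeff_vec linear_scale[OF linear_coeff_vec_left]
      linear_scale[OF linear_coeff_vec_right] power2_eq_square)

lemma rank_one_inner: "rank_one t \<bullet>\<bullet> D = t \<bullet> (D *v t)"
proof -
  have "rank_one t \<bullet>\<bullet> D = (\<Sum>i\<in>UNIV. \<Sum>j\<in>UNIV. t $ i * t $ j * D $ j $ i)"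
    by (simp add: mat_inner_def trace_def matrix_matrix_mult_def rank_one_def)
  also have "\<dots> = (\<Sum>j\<in>UNIV. \<Sum>i\<in>UNIV. t $ i * t $ j * D $ j $ i)"
    by (rule sum.swap)
  also have "\<dots> = t \<bullet> (D *v t)"
    by (simp add: inner_vec_def matrix_vector_mult_def sum_distrib_left mult_ac)
  finally show ?thesis .
qed

lemma convex_cone_completely_positive: "convex_cone (completely_positive :: (real^'p^'p) set)"
proof -
  have "r *\<^sub>R rank_one t = rank_one (sqrt r *\<^sub>R t)" if "0 \<le> r" for r and t :: "real^'p"
    using that by (simp add: rank_one_def vec_eq_iff)
  moreover have "sqrt r *\<^sub>R t \<in> nonneg_vectors" if "0 \<le> r" "t \<in> nonneg_vectors"
    for r and t :: "real^'p"
    using that by (simp add: nonneg_vectors_def)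
  ultimately have "conic (rank_one ` (nonneg_vectors :: (real^'p) set))"
    unfolding conic_def by blast
  moreover have "0 \<in> (nonneg_vectors :: (real^'p) set)" by (simp add: nonneg_vectors_def)
  ultimately show ?thesis
    unfolding completely_positive_def convex_cone_def
    using cone_convex_hull[of "rank_one ` (nonneg_vectors :: (real^'p) set)"]
    by (auto simp: cone_def conic_def)
qed

text \<open>
  The dual feasible region as seen by the objective and the constraints: a completely positive matrix
  is a conic combination of matrices \<open>t t\<^sup>T\<close>, and the moments of \<open>t t\<^sup>T\<close> form \<open>a(t)\<close>.
\<close>

lemma completely_positive_moments:
  "(\<lambda>U. (U \<bullet>\<bullet> A0, \<chi> m. U \<bullet>\<bullet> A m)) ` completely_positive = fin_cone (a_vec A0 A ` simplex_T)"
  (is "?\<Phi> ` _ = ?C")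
proof
  have lin: "linear ?\<Phi>"
    by (rule linearI)
       (auto simp: mat_inner_def vec_eq_iff trace_def matrix_matrix_mult_def algebra_simps
          sum.distrib sum_distrib_left)
  have \<Phi>: "?\<Phi> (rank_one t) = a_vec A0 A t" for t
    by (simp add: rank_one_inner a_vec_def)
  show "?\<Phi> ` completely_positive \<subseteq> ?C"
  proof -
    have "a_vec A0 A t \<in> ?C" if t: "t \<in> nonneg_vectors" for t
    proof (cases "t = 0")
      case True
      then have "a_vec A0 A t = 0" using a_vec_scaleR[of A0 A 0 t] by simp
      then show ?thesis using convex_cone_contains_0[OF convex_cone_fin_cone] by simp
    next
      case False
      then obtain r s where "r > 0" "s \<in> simplex_T" "t = r *\<^sub>R s"
        by (rule normalize_in_simplex[OF t])
      then show ?thesis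
        using convex_cone_scaleR[OF convex_cone_fin_cone, of "r\<^sup>2" "a_vec A0 A s"]
        by (simp add: a_vec_scaleR fin_cone_inc)
    qed
    then have "convex hull (?\<Phi> ` rank_one ` nonneg_vectors) \<subseteq> ?C"
      using convex_cone_fin_cone \<Phi> by (intro hull_minimal) (auto simp: convex_cone_def)
    then show ?thesis
      by (simp only: completely_positive_def convex_hull_linear_image[OF lin])
  qed
  show "?C \<subseteq> ?\<Phi> ` completely_positive"
  proof (rule fin_cone_minimal)
    show "convex_cone (?\<Phi> ` completely_positive)"
      using convex_cone_linear_image lin convex_cone_completely_positive by blast
    have "rank_one t \<in> completely_positive" if "t \<in> simplex_T" for t :: "real^'p"
      using that by (auto simp: completely_positive_def simplex_T_def intro: hull_inc)
    then show "a_vec A0 A ` simplex_T \<subseteq> ?\<Phi> ` completely_positive"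
      by (auto simp flip: \<Phi>)
  qed
qed

section \<open>Consistent copositive systems with immobile indices\<close>

locale copositive_system =
  fixes A0 :: "real^'p^'p" and A :: "'n::finite \<Rightarrow> real^'p^'p"
  assumes sym0: "A0 \<in> symmetric_matrices"
    and sym: "\<And>m. A m \<in> symmetric_matrices"
    and feasible_nonempty: "feasible A0 A \<noteq> {}"
    and T_im_nonempty: "T_im A0 A \<noteq> {}"
begin

abbreviation "X \<equiv> feasible A0 A"
abbreviation "V \<equiv> vertices_im A0 A"
abbreviation "av \<equiv> a_vec A0 A"
abbreviation "bv \<equiv> b_vec A0 A"
abbreviation "K \<equiv> fin_cone (G_set A0 A)"

text \<open>
  The inequalities \<open>s\<^sub>0 + s \<bullet> x \<ge> 0\<close> that hold on the feasible set, encoded by their coefficient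
  vectors \<open>(s\<^sub>0, s)\<close>.
\<close>

definition valid_ineqs :: "(real \<times> (real^'n)) set" where
  "valid_ineqs = {z. \<forall>x\<in>X. 0 \<le> (1, x) \<bullet> z}"

lemma inner_av: "(1, x) \<bullet> av t = t \<bullet> (pencil A0 A x *v t)"
  by (simp add: a_vec_eq_coeff_vec inner_coeff_vec)

lemma inner_bv: "(1, x) \<bullet> bv k \<tau> = axis k 1 \<bullet> (pencil A0 A x *v \<tau>)"
  by (simp add: b_vec_eq_coeff_vec inner_coeff_vec)

lemma pencil_symmetric: "pencil A0 A x \<in> symmetric_matrices"
  using symmetric_pencil sym0 sym by blast

lemma feasible_iff_nonneg: "x \<in> X \<longleftrightarrow> (\<forall>t\<in>nonneg_vectors. 0 \<le> (1, x) \<bullet> av t)"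
  using pencil_symmetric by (auto simp: feasible_def copositive_def inner_av)

lemma feasible_iff: "x \<in> X \<longleftrightarrow> (\<forall>t\<in>simplex_T. 0 \<le> (1, x) \<bullet> av t)"
proof
  assume r: "\<forall>t\<in>simplex_T. 0 \<le> (1, x) \<bullet> av t"
  have "0 \<le> (1, x) \<bullet> av t" if t: "t \<in> nonneg_vectors" for t
  proof (cases "t = 0")
    case True
    then show ?thesis by (simp add: inner_av)
  next
    case False
    then obtain q s where "q > 0" "s \<in> simplex_T" "t = q *\<^sub>R s"
      by (rule normalize_in_simplex[OF t])
    then show ?thesis using r by (auto simp: a_vec_scaleR)
  qed
  then show "x \<in> X" by (simp add: feasible_iff_nonneg)
qed (simp add: feasible_iff_nonneg simplex_T_def)

lemma convex_feasible: "convex X"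
proof -
  have "X = (\<Inter>t\<in>simplex_T. {x. - fst (av t) \<le> snd (av t) \<bullet> x})"
    by (auto simp: feasible_iff inner_prod_def inner_commute[of "snd (av _)"]
        simp flip: diff_le_eq) (force simp: algebra_simps)+
  then show ?thesis by (auto intro!: convex_INT simp: convex_halfspace_ge)
qed

lemma convex_cone_valid_ineqs: "convex_cone valid_ineqs"
  by (auto simp: convex_cone_iff valid_ineqs_def inner_add_right)

lemma G_set_valid: "G_set A0 A \<subseteq> valid_ineqs"
  by (auto simp: G_set_def valid_ineqs_def feasible_iff)

lemma cone_G_valid: "K \<subseteq> valid_ineqs"
  by (intro fin_cone_minimal G_set_valid convex_cone_valid_ineqs)

text \<open>
  From a relative interior point \<open>x\<close>, the segment from any feasible \<open>y\<close> through \<open>x\<close> can be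
  prolonged inside \<open>X\<close>; an affine function that is nonnegative on \<open>X\<close> and vanishes at \<open>x\<close> would
  become negative there if it were positive at \<open>y\<close>.
\<close>

lemma valid_ineq_equality:
  assumes x: "x \<in> rel_interior X" and z: "z \<in> valid_ineqs" "(1, x) \<bullet> z = 0" and y: "y \<in> X"
  shows "(1, y) \<bullet> z = 0"
proof -
  obtain e where e: "e > 1" "(1 - e) *\<^sub>R y + e *\<^sub>R x \<in> X"
    using convex_rel_interior_iff[OF convex_feasible feasible_nonempty] x y by blast
  have "(1, (1 - e) *\<^sub>R y + e *\<^sub>R x) \<bullet> z = (1 - e) * ((1, y) \<bullet> z) + e * ((1, x) \<bullet> z)"
    by (simp add: inner_prod_def inner_add_left algebra_simps)
  moreover have "0 \<le> (1, (1 - e) *\<^sub>R y + e *\<^sub>R x) \<bullet> z"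
    using z(1) e(2) by (simp add: valid_ineqs_def)
  ultimately have "0 \<le> (1 - e) * ((1, y) \<bullet> z)" using z(2) by simp
  moreover have "0 \<le> (1, y) \<bullet> z" using z(1) y by (simp add: valid_ineqs_def)
  ultimately show ?thesis using e(1) by (simp add: zero_le_mult_iff)
qed

subsection \<open>Uniform duality as a Farkas property of the cone of \<open>G\<close>\<close>

text \<open>
  Weak duality: the right-hand side is the product of \<open>U\<close> with the copositive matrix of \<open>x\<close>.
\<close>

lemma completely_positive_moments_valid:
  assumes "U \<in> completely_positive" "x \<in> X"
  shows "0 \<le> U \<bullet>\<bullet> A0 + x \<bullet> (\<chi> m. U \<bullet>\<bullet> A m)"
proof -
  have "(U \<bullet>\<bullet> A0, \<chi> m. U \<bullet>\<bullet> A m) \<in> fin_cone (av ` simplex_T)"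
    using assms by (auto simp flip: completely_positive_moments)
  also have "\<dots> \<subseteq> valid_ineqs"
    using cone_G_valid fin_cone_mono[of "av ` simplex_T" "G_set A0 A"] by (auto simp: G_set_def)
  finally show ?thesis using assms by (simp add: valid_ineqs_def)
qed

text \<open>
  The valid inequality \<open>(s\<^sub>0, s)\<close> bounds the primal problem with cost \<open>s\<close>. A dual optimal
  solution puts the sharpest such inequality into the cone, and a multiple of \<open>(1, 0)\<close>
  makes up the slack in the constant.
\<close>

lemma uniform_LP_duality_imp_valid_in_cone:
  assumes U: "uniform_LP_duality A0 A" and z: "z \<in> valid_ineqs"
  shows "z \<in> K"
proof -
  obtain s0 s where z_eq: "z = (s0, s)" by (cases z)
  have low: "- s0 \<le> s \<bullet> x" if "x \<in> X" for x
  proof -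
    have "0 \<le> (1, x) \<bullet> z" using z that by (simp add: valid_ineqs_def)
    then show ?thesis by (simp add: z_eq inner_commute)
  qed
  then have bound: "ereal (- s0) \<le> val_P A0 A s"
    unfolding val_P_def by (intro INF_greatest) simp
  then have "val_P A0 A s > - \<infinity>" by (rule less_le_trans[rotated]) simp
  then obtain U where U: "dual_optimal A0 A s U" "val_P A0 A s = val_D A0 A s"
    using U by (auto simp: uniform_LP_duality_def)
  have "val_D A0 A s \<le> ereal (- (U \<bullet>\<bullet> A0))"
    unfolding val_D_def using U(1) by (intro SUP_least) (simp add: dual_optimal_def)
  then have "ereal (- s0) \<le> ereal (- (U \<bullet>\<bullet> A0))" using bound U(2) by (metis order_trans)
  then have r: "0 \<le> s0 - U \<bullet>\<bullet> A0" by simp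
  have "(U \<bullet>\<bullet> A0, \<chi> m. U \<bullet>\<bullet> A m) \<in> fin_cone (av ` simplex_T)"
    using U(1) by (auto simp: dual_optimal_def dual_feasible_def simp flip: completely_positive_moments)
  moreover have "(\<chi> m. U \<bullet>\<bullet> A m) = s"
    using U(1) by (simp add: dual_optimal_def dual_feasible_def vec_eq_iff)
  ultimately have "(U \<bullet>\<bullet> A0, s) \<in> K"
    using fin_cone_mono[of "av ` simplex_T" "G_set A0 A"] by (auto simp: G_set_def)
  moreover have "(s0 - U \<bullet>\<bullet> A0) *\<^sub>R (1, 0) \<in> K"
    using r by (intro convex_cone_scaleR[OF convex_cone_fin_cone] fin_cone_inc) (auto simp: G_set_def)
  ultimately have "(U \<bullet>\<bullet> A0, s) + (s0 - U \<bullet>\<bullet> A0) *\<^sub>R (1, 0) \<in> K"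
    by (rule convex_cone_add[OF convex_cone_fin_cone])
  then show ?thesis by (simp add: z_eq)
qed

text \<open>
  The inequality with the optimal value as its constant is valid. In its conic representation the
  coefficient \<open>r\<close> of \<open>(1, 0)\<close> is zero by weak duality, and the rest is the moment vector of a dual
  solution.
\<close>

lemma valid_in_cone_imp_uniform_LP_duality:
  assumes sub: "valid_ineqs \<subseteq> K"
  shows "uniform_LP_duality A0 A"
  unfolding uniform_LP_duality_def
proof (intro allI impI)
  fix c :: "real^'n" assume fin: "val_P A0 A c > - \<infinity>"
  obtain x0 where x0: "x0 \<in> X" using feasible_nonempty by blast
  have "val_P A0 A c \<le> ereal (c \<bullet> x0)" unfolding val_P_def by (rule INF_lower[OF x0])
  with fin obtain v where v: "val_P A0 A c = ereal v" by (cases "val_P A0 A c") auto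
  have low: "v \<le> c \<bullet> x" if "x \<in> X" for x
  proof -
    have "ereal v \<le> ereal (c \<bullet> x)" unfolding v[symmetric] val_P_def by (rule INF_lower[OF that])
    then show ?thesis by simp
  qed
  then have "(- v, c) \<in> valid_ineqs" by (auto simp: valid_ineqs_def inner_commute)
  then have "(- v, c) \<in> fin_cone (av ` simplex_T \<union> {(1, 0)})"
    using sub by (auto simp: G_set_def)
  then obtain u g where u: "u \<in> fin_cone (av ` simplex_T)" and g: "g \<in> fin_cone {(1, 0)}"
    and split: "(- v, c) = u + g"
    unfolding fin_cone_Un by blast
  have "fin_cone {(1::real, 0::real^'n)} \<subseteq> {0..} \<times> {0}"
    by (rule fin_cone_minimal) (auto simp: convex_cone_iff zero_prod_def)
  then obtain r where r: "g = (r, 0)" "0 \<le> r" using g by auto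
  obtain U where U: "U \<in> completely_positive" "u = (U \<bullet>\<bullet> A0, \<chi> m. U \<bullet>\<bullet> A m)"
    using u unfolding completely_positive_moments[symmetric] by blast
  have obj: "U \<bullet>\<bullet> A0 = - v - r" and c: "c = (\<chi> m. U \<bullet>\<bullet> A m)"
    using split r U(2) by auto
  have feas: "U \<in> dual_feasible A c" using U(1) c by (simp add: dual_feasible_def)
  have weak: "- (D \<bullet>\<bullet> A0) \<le> v" if D: "D \<in> dual_feasible A c" for D
  proof -
    have "(\<chi> m. D \<bullet>\<bullet> A m) = c" using D by (simp add: dual_feasible_def vec_eq_iff)
    then have "- (D \<bullet>\<bullet> A0) \<le> c \<bullet> x" if "x \<in> X" for x
      using completely_positive_moments_valid[of D x] D that
      by (simp add: dual_feasible_def inner_commute)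
    then have "ereal (- (D \<bullet>\<bullet> A0)) \<le> val_P A0 A c"
      unfolding val_P_def by (intro INF_greatest) simp
    then show ?thesis by (simp add: v)
  qed
  have "r = 0" using weak[OF feas] obj r(2) by simp
  then have opt: "- (U \<bullet>\<bullet> A0) = v" using obj by simp
  have "dual_optimal A0 A c U" using feas weak opt by (simp add: dual_optimal_def)
  moreover have "val_D A0 A c = ereal v"
  proof (rule antisym)
    show "val_D A0 A c \<le> ereal v" unfolding val_D_def using weak by (intro SUP_least) simp
    show "ereal v \<le> val_D A0 A c" unfolding val_D_def opt[symmetric] by (rule SUP_upper[OF feas])
  qed
  ultimately show "(\<exists>U. dual_optimal A0 A c U) \<and> val_P A0 A c = val_D A0 A c"
    using v by auto
qed

subsection \<open>Immobile indices and their vertices\<close>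

lemma T_imD:
  assumes "\<tau> \<in> T_im A0 A"
  shows "\<tau> \<in> simplex_T" "\<tau> \<in> nonneg_vectors" "x \<in> X \<Longrightarrow> \<tau> \<bullet> (pencil A0 A x *v \<tau>) = 0"
  using assms by (auto simp: T_im_def simplex_T_def)

lemma vertices_subset_T_im: "V \<subseteq> T_im A0 A"
  using extreme_points_of_convex_hull by (auto simp: vertices_im_def)

lemma feasible_copositive: "x \<in> X \<Longrightarrow> pencil A0 A x \<in> copositive"
  by (simp add: feasible_def)

lemma coeff_vec_immobile_valid:
  assumes "\<tau> \<in> T_im A0 A" "u \<in> nonneg_vectors"
  shows "coeff_vec A0 A u \<tau> \<in> valid_ineqs"
  using copositive_gradient_nonneg[OF feasible_copositive T_imD(2,3)[OF assms(1)] assms(2)]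
  by (simp add: valid_ineqs_def inner_coeff_vec)

lemma b_vec_valid:
  assumes "\<tau> \<in> V"
  shows "bv k \<tau> \<in> valid_ineqs"
  unfolding b_vec_eq_coeff_vec
  using assms vertices_subset_T_im
  by (intro coeff_vec_immobile_valid) (auto simp: nonneg_vectors_def axis_def)

lemma compact_T_im: "compact (T_im A0 A)"
proof -
  have "T_im A0 A = simplex_T \<inter> (\<Inter>x\<in>X. {t. t \<bullet> (pencil A0 A x *v t) = 0})"
    by (auto simp: T_im_def)
  moreover have "closed (\<Inter>x\<in>X. {t. t \<bullet> (pencil A0 A x *v t) = 0})"
    by (intro closed_INT ballI closed_Collect_eq continuous_on_inner continuous_on_id
        continuous_on_const linear_continuous_on matrix_vector_mul_bounded_linear)
  ultimately show ?thesis by (simp add: compact_Int_closed compact_simplex_T)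
qed

lemma convex_hull_vertices: "convex hull V = convex hull (T_im A0 A)"
  unfolding vertices_im_def
  by (rule Krein_Milman_Minkowski[symmetric])
     (auto simp: compact_convex_hull compact_T_im)

lemma vertices_nonempty: "V \<noteq> {}"
  using convex_hull_vertices T_im_nonempty convex_hull_eq_empty[of V]
    convex_hull_eq_empty[of "T_im A0 A"] by simp

text \<open>
  For \<open>\<tau>'\<close> supported inside the support of \<open>\<tau>\<close>, complementary slackness makes the mixed term
  \<open>\<tau>' \<bullet> (D \<tau>)\<close> vanish, so the form is zero on the whole line through both points. This line can be
  prolonged beyond \<open>\<tau>\<close> within the simplex, contradicting extremality of \<open>\<tau>\<close>.
\<close>

lemma vertex_support_minimal:
  assumes "\<tau> \<in> V" "\<tau>' \<in> T_im A0 A" and supp: "\<And>k. \<tau>' $ k > 0 \<Longrightarrow> \<tau> $ k > 0"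
  shows "\<tau>' = \<tau>"
proof (rule ccontr)
  assume neq: "\<tau>' \<noteq> \<tau>"
  have \<tau>: "\<tau> \<in> T_im A0 A" using assms vertices_subset_T_im by blast
  note \<tau>D = T_imD[OF \<tau>] and \<tau>'D = T_imD[OF assms(2)]
  \<comment> \<open>a step that keeps the positive entries of \<open>\<tau>\<close> nonnegative, as those of \<open>\<tau>'\<close> are at most \<open>1\<close>\<close>
  obtain e where e: "e > 0" "\<And>k. \<tau> $ k > 0 \<Longrightarrow> e \<le> \<tau> $ k"
    by (rule finite_pos_lower_bound[of "\<lambda>k. \<tau> $ k"]) blast
  define s where "s = (1 + e) *\<^sub>R \<tau> + (- e) *\<^sub>R \<tau>'"
  have le1: "\<tau>' $ k \<le> 1" for k
    using \<tau>'D(1) member_le_sum[of k UNIV "\<lambda>k. \<tau>' $ k"]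
    by (auto simp: simplex_T_def nonneg_vectors_def)
  have nn: "0 \<le> \<tau> $ k" "0 \<le> \<tau>' $ k" for k
    using \<tau>D(2) \<tau>'D(2) by (auto simp: nonneg_vectors_def)
  have "0 \<le> s $ k" for k
  proof (cases "\<tau> $ k > 0")
    case True
    have "e * \<tau>' $ k \<le> e * 1" using le1 e(1) by (intro mult_left_mono) auto
    also have "\<dots> \<le> \<tau> $ k" using e(2) True by simp
    also have "\<dots> \<le> (1 + e) * \<tau> $ k" using e(1) nn by (simp add: algebra_simps)
    finally show ?thesis by (simp add: s_def)
  next
    case False
    then have "\<tau> $ k = 0" "\<tau>' $ k = 0" using nn[of k] supp[of k] by force+
    then show ?thesis by (simp add: s_def)
  qed
  moreover have "(\<Sum>k\<in>UNIV. s $ k) = 1"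
    using \<tau>D(1) \<tau>'D(1)
    by (simp add: s_def simplex_T_def sum.distrib sum_negf sum_subtractf flip: sum_distrib_left)
  ultimately have s: "s \<in> simplex_T" by (simp add: simplex_T_def nonneg_vectors_def)
  have "s \<bullet> (pencil A0 A x *v s) = 0" if x: "x \<in> X" for x
  proof -
    let ?D = "pencil A0 A x"
    have "(?D *v \<tau>) $ k = 0" if "\<tau>' $ k \<noteq> 0" for k
    proof -
      have "\<tau> $ k > 0" using that supp nn[of k] by force
      then show ?thesis
        using copositive_gradient_zero_on_support[OF feasible_copositive[OF x] \<tau>D(2) \<tau>D(3)[OF x]]
        by (simp add: inner_axis')
    qed
    then have "\<tau>' \<bullet> (?D *v \<tau>) = 0" unfolding inner_vec_def by (intro sum.neutral) auto
    moreover have "\<tau> \<bullet> (?D *v \<tau>') = \<tau>' \<bullet> (?D *v \<tau>)"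
      by (rule symmetric_inner_commute[OF pencil_symmetric])
    moreover have "s \<bullet> (?D *v s) = (1 + e) *\<^sub>R \<tau> \<bullet> (?D *v ((1 + e) *\<^sub>R \<tau>))
        + 2 * (- e) * ((1 + e) *\<^sub>R \<tau> \<bullet> (?D *v \<tau>')) + (- e)\<^sup>2 * (\<tau>' \<bullet> (?D *v \<tau>'))"
      unfolding s_def by (rule quadratic_form_add[OF pencil_symmetric])
    ultimately show ?thesis
      using \<tau>D(3)[OF x] \<tau>'D(3)[OF x] by (simp add: matrix_vector_mult_scaleR)
  qed
  then have "s \<in> T_im A0 A" using s by (simp add: T_im_def)
  then have mem: "s \<in> convex hull (T_im A0 A)" "\<tau>' \<in> convex hull (T_im A0 A)"
    using assms(2) by (auto intro: hull_inc)
  have "s - \<tau>' = (1 + e) *\<^sub>R (\<tau> - \<tau>')" by (simp add: s_def algebra_simps)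
  then have "s \<noteq> \<tau>'" using neq e(1) by auto
  moreover have "\<tau> = (1 - e / (1 + e)) *\<^sub>R s + (e / (1 + e)) *\<^sub>R \<tau>'"
  proof -
    have "1 - e / (1 + e) = 1 / (1 + e)" using e(1) by (simp add: field_simps)
    then show ?thesis using e(1) by (simp add: s_def scaleR_diff_right)
  qed
  ultimately have "\<tau> \<in> open_segment s \<tau>'"
    unfolding in_segment using e(1) by (intro conjI exI[of _ "e / (1 + e)"]) auto
  then show False using assms(1) mem by (auto simp: vertices_im_def extreme_point_of_def)
qed

lemma finite_vertices: "finite V"
proof (rule inj_on_finite)
  show "inj_on (\<lambda>\<tau>. {k. \<tau> $ k > 0}) V"
  proof (rule inj_onI)
    fix \<tau> \<tau>' assume h: "\<tau> \<in> V" "\<tau>' \<in> V" "{k. \<tau> $ k > 0} = {k. \<tau>' $ k > 0}"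
    then have "\<tau>' \<in> T_im A0 A" "\<And>k. \<tau>' $ k > 0 \<Longrightarrow> \<tau> $ k > 0"
      using vertices_subset_T_im by auto
    then show "\<tau> = \<tau>'" by (rule vertex_support_minimal[OF h(1), symmetric])
  qed
qed auto

lemma vertex_has_positive_entry:
  assumes "\<tau> \<in> V"
  obtains k where "\<tau> $ k > 0"
proof -
  have "\<tau> \<in> simplex_T" using assms vertices_subset_T_im T_imD by blast
  then have "(\<Sum>k\<in>UNIV. \<tau> $ k) = 1" "\<And>k. 0 \<le> \<tau> $ k"
    by (auto simp: simplex_T_def nonneg_vectors_def)
  moreover have "\<exists>k. \<tau> $ k \<noteq> 0"
    using \<open>(\<Sum>k\<in>UNIV. \<tau> $ k) = 1\<close> by (rule_tac ccontr) simp
  ultimately show thesis using that unfolding less_le by metis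
qed

lemma sigma_pos: "0 < sigma A0 A"
  and sigma_le: "\<tau> \<in> V \<Longrightarrow> \<tau> $ k > 0 \<Longrightarrow> sigma A0 A \<le> \<tau> $ k"
proof -
  let ?S = "{\<tau> $ k | \<tau> k. \<tau> \<in> V \<and> \<tau> $ k > 0}"
  have "?S \<subseteq> (\<lambda>(\<tau>, k). \<tau> $ k) ` (V \<times> UNIV)" by auto
  then have fin: "finite ?S" by (rule finite_subset) (simp add: finite_vertices)
  obtain \<tau>0 where "\<tau>0 \<in> V" using vertices_nonempty by blast
  moreover from \<open>\<tau>0 \<in> V\<close> obtain i where "\<tau>0 $ i > 0" by (rule vertex_has_positive_entry)
  ultimately have "?S \<noteq> {}" by blast
  then show "0 < sigma A0 A" unfolding sigma_def using fin by (subst Min_gr_iff) auto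
  show "\<tau> \<in> V \<Longrightarrow> \<tau> $ k > 0 \<Longrightarrow> sigma A0 A \<le> \<tau> $ k"
    unfolding sigma_def using fin by (intro Min_le) auto
qed

lemma finite_F: "finite (F_set A0 A)"
proof -
  have "F_set A0 A \<subseteq> (\<Union>\<tau>\<in>V. range (\<lambda>k. bv k \<tau>))" by (auto simp: F_set_def)
  then show ?thesis by (rule finite_subset) (simp add: finite_vertices)
qed

subsection \<open>The region \<open>\<Omega>\<close> away from the immobile indices\<close>

lemma Omega_iff:
  "t \<in> Omega A0 A \<longleftrightarrow> t \<in> simplex_T \<and>
     (\<forall>\<tau>\<in>convex hull (T_im A0 A). sigma A0 A \<le> (\<Sum>k\<in>UNIV. \<bar>t $ k - \<tau> $ k\<bar>))"
proof -
  have "bdd_below ((\<lambda>\<tau>. \<Sum>k\<in>UNIV. \<bar>t $ k - \<tau> $ k\<bar>) ` (convex hull (T_im A0 A)))"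
    by (intro bdd_belowI2[of _ 0] sum_nonneg) auto
  then show ?thesis
    using T_im_nonempty by (simp add: Omega_def rho_def le_cINF_iff)
qed

lemma compact_Omega: "compact (Omega A0 A)"
proof -
  have "Omega A0 A = simplex_T \<inter>
      (\<Inter>\<tau>\<in>convex hull (T_im A0 A). {t. sigma A0 A \<le> (\<Sum>k\<in>UNIV. \<bar>t $ k - \<tau> $ k\<bar>)})"
    by (auto simp: Omega_iff)
  moreover have
    "closed (\<Inter>\<tau>\<in>convex hull (T_im A0 A). {t. sigma A0 A \<le> (\<Sum>k\<in>UNIV. \<bar>t $ k - \<tau> $ k\<bar>)})"
    by (intro closed_INT ballI closed_Collect_le continuous_intros)
  ultimately show ?thesis by (simp add: compact_Int_closed compact_simplex_T)
qed

lemma Omega_disjoint_T_im: "Omega A0 A \<inter> T_im A0 A = {}"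
proof (rule ccontr)
  assume "\<not> ?thesis"
  then obtain t where "t \<in> Omega A0 A" "t \<in> T_im A0 A" by blast
  then have "sigma A0 A \<le> (\<Sum>k\<in>UNIV. \<bar>t $ k - t $ k\<bar>)"
    unfolding Omega_iff by (meson hull_inc)
  then show False using sigma_pos by simp
qed

text \<open>
  Each vertex has an entry of size at least \<open>\<sigma>\<close> outside the support of \<open>t\<close>. The mass outside this
  support is linear, so it is at least \<open>\<sigma>\<close> on the convex hull as well, and it is a lower bound
  for the distance to \<open>t\<close>.
\<close>

lemma in_Omega_if_no_vertex_support_contained:
  assumes t: "t \<in> simplex_T" and V: "\<And>\<tau>. \<tau> \<in> V \<Longrightarrow> \<exists>k. \<tau> $ k > 0 \<and> t $ k = 0"
  shows "t \<in> Omega A0 A"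
  unfolding Omega_iff
proof (intro conjI ballI t)
  fix \<tau> assume "\<tau> \<in> convex hull (T_im A0 A)"
  then have "\<tau> \<in> convex hull V" by (simp add: convex_hull_vertices)
  \<comment> \<open>the mass that \<open>\<tau>\<close> puts outside the support of \<open>t\<close>\<close>
  let ?m = "\<lambda>\<tau>. \<Sum>k\<in>{k. t $ k = 0}. \<tau> $ k"
  have "convex {\<tau>. sigma A0 A \<le> ?m \<tau>}"
    unfolding convex_def mem_Collect_eq
  proof (intro ballI allI impI, unfold mem_Collect_eq)
    fix x y and u v :: real
    assume h: "sigma A0 A \<le> ?m x" "sigma A0 A \<le> ?m y" "0 \<le> u" "0 \<le> v" "u + v = 1"
    have "?m (u *\<^sub>R x + v *\<^sub>R y) = u * ?m x + v * ?m y"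
      by (simp add: sum.distrib sum_distrib_left)
    also have "\<dots> \<ge> u * sigma A0 A + v * sigma A0 A"
      using h by (intro add_mono mult_left_mono) auto
    finally show "sigma A0 A \<le> ?m (u *\<^sub>R x + v *\<^sub>R y)"
      using h(5) by (simp flip: distrib_right)
  qed
  moreover have "V \<subseteq> {\<tau>. sigma A0 A \<le> ?m \<tau>}"
  proof
    fix \<tau>' assume v: "\<tau>' \<in> V"
    obtain k where k: "\<tau>' $ k > 0" "t $ k = 0" using V[OF v] by blast
    have "0 \<le> \<tau>' $ i" for i
      using v vertices_subset_T_im T_imD(2) by (auto simp: nonneg_vectors_def)
    then have "\<tau>' $ k \<le> ?m \<tau>'" using k by (intro member_le_sum) auto
    then show "\<tau>' \<in> {\<tau>. sigma A0 A \<le> ?m \<tau>}" using sigma_le[OF v k(1)] by simp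
  qed
  ultimately have "sigma A0 A \<le> ?m \<tau>"
    using \<open>\<tau> \<in> convex hull V\<close> hull_minimal[of V _ convex] by blast
  also have "\<dots> \<le> (\<Sum>k\<in>{k. t $ k = 0}. \<bar>t $ k - \<tau> $ k\<bar>)"
    by (intro sum_mono) auto
  also have "\<dots> \<le> (\<Sum>k\<in>UNIV. \<bar>t $ k - \<tau> $ k\<bar>)"
    by (intro sum_mono2) auto
  finally show "sigma A0 A \<le> (\<Sum>k\<in>UNIV. \<bar>t $ k - \<tau> $ k\<bar>)" .
qed

text \<open>
  With \<open>t = s + a \<tau>\<close> and \<open>s, a \<ge> 0\<close>, the condition \<open>D \<tau> \<ge> 0\<close> gives
  \<open>t \<bullet> (D t) \<ge> s \<bullet> (D s)\<close>. Choosing \<open>a\<close> maximal removes an index from the support, which drives the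
  induction; it stops at multiples of points of \<open>\<Omega>\<close>.
\<close>

lemma copositivity_test_on_Omega_and_vertices:
  assumes D: "D \<in> symmetric_matrices"
    and \<Omega>: "\<And>t. t \<in> Omega A0 A \<Longrightarrow> 0 \<le> t \<bullet> (D *v t)"
    and V: "\<And>\<tau> k. \<tau> \<in> V \<Longrightarrow> 0 \<le> axis k 1 \<bullet> (D *v \<tau>)"
    and t: "t \<in> nonneg_vectors"
  shows "0 \<le> t \<bullet> (D *v t)"
  using t
proof (induction "card {k. t $ k > 0}" arbitrary: t rule: less_induct)
  case less
  have tnn: "0 \<le> t $ k" for k using less.prems by (simp add: nonneg_vectors_def)
  show ?case
  proof (cases "\<exists>\<tau>\<in>V. \<forall>k. \<tau> $ k > 0 \<longrightarrow> t $ k > 0")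
    case True
    then obtain \<tau> where \<tau>: "\<tau> \<in> V" and supp: "\<And>k. \<tau> $ k > 0 \<Longrightarrow> t $ k > 0" by blast
    have \<tau>nn: "\<tau> \<in> nonneg_vectors" using \<tau> vertices_subset_T_im T_imD by blast
    let ?R = "{t $ k / \<tau> $ k | k. \<tau> $ k > 0}"
    have fin: "finite ?R" by simp
    obtain i where "\<tau> $ i > 0" using vertex_has_positive_entry[OF \<tau>] .
    then have "?R \<noteq> {}" by blast
    \<comment> \<open>the largest multiple of \<open>\<tau>\<close> that can be taken off \<open>t\<close> inside the orthant\<close>
    define a where "a = Min ?R"
    have "a \<in> ?R" unfolding a_def by (rule Min_in[OF fin \<open>?R \<noteq> {}\<close>])
    then obtain j where j: "\<tau> $ j > 0" "a = t $ j / \<tau> $ j" by blast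
    have a0: "0 \<le> a" using j tnn by simp
    have a_le: "a * \<tau> $ k \<le> t $ k" if "\<tau> $ k > 0" for k
    proof -
      have "a \<le> t $ k / \<tau> $ k" unfolding a_def using that by (intro Min_le[OF fin]) auto
      then show ?thesis using that by (simp add: field_simps)
    qed
    define s where "s = t - a *\<^sub>R \<tau>"
    have zero: "\<tau> $ k = 0" if "\<not> \<tau> $ k > 0" for k
      using that \<tau>nn by (auto simp: nonneg_vectors_def not_less intro: antisym)
    have snn: "s \<in> nonneg_vectors"
      unfolding nonneg_vectors_def s_def
    proof (intro CollectI allI)
      fix k show "0 \<le> (t - a *\<^sub>R \<tau>) $ k"
        using a_le[of k] zero[of k] tnn[of k] by (cases "\<tau> $ k > 0") auto
    qed
    have sub: "s $ k \<le> t $ k" for k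
      using a0 \<tau>nn by (simp add: s_def nonneg_vectors_def)
    have "s $ j = 0" using j by (simp add: s_def)
    then have "{k. s $ k > 0} \<subset> {k. t $ k > 0}"
      using sub supp[OF j(1)] by (force intro: less_le_trans)
    then have "card {k. s $ k > 0} < card {k. t $ k > 0}" by (intro psubset_card_mono) auto
    then have IH: "0 \<le> s \<bullet> (D *v s)" using less.hyps snn by blast
    have "t \<bullet> (D *v t) = s \<bullet> (D *v s) + 2 * a * (s \<bullet> (D *v \<tau>)) + a\<^sup>2 * (\<tau> \<bullet> (D *v \<tau>))"
      using quadratic_form_add[OF D, of s a \<tau>] by (simp add: s_def)
    moreover have "0 \<le> s \<bullet> (D *v \<tau>)" "0 \<le> \<tau> \<bullet> (D *v \<tau>)"
      using snn \<tau>nn V[OF \<tau>] by (auto intro: coordinatewise_nonneg_inner)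
    ultimately show ?thesis using IH a0 by simp
  next
    case False
    show ?thesis
    proof (cases "t = 0")
      case False
      obtain r u where r: "r > 0" and u: "u \<in> simplex_T" and tu: "t = r *\<^sub>R u"
        by (rule normalize_in_simplex[OF less.prems False])
      have "u \<in> Omega A0 A"
      proof (rule in_Omega_if_no_vertex_support_contained[OF u])
        fix \<tau> assume "\<tau> \<in> V"
        then obtain k where "\<tau> $ k > 0" "\<not> t $ k > 0"
          using \<open>\<not> (\<exists>\<tau>\<in>V. \<forall>k. \<tau> $ k > 0 \<longrightarrow> t $ k > 0)\<close> by blast
        then show "\<exists>k. \<tau> $ k > 0 \<and> u $ k = 0"
          using tnn[of k] r tu by (intro exI[of _ k]) auto
      qed
      then show ?thesis using \<Omega>[of u] r by (simp add: tu matrix_vector_mult_scaleR)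
    qed simp
  qed
qed

subsection \<open>The equalities implied by the immobile indices\<close>

lemma F_setD:
  assumes "f \<in> F_set A0 A"
  shows "f \<in> valid_ineqs" "x \<in> X \<Longrightarrow> (1, x) \<bullet> f = 0"
proof -
  obtain k \<tau> where f: "f = bv k \<tau>" "\<tau> \<in> V" "k \<in> M_set A0 A \<tau>"
    using assms unfolding F_set_def by blast
  show "f \<in> valid_ineqs" using f b_vec_valid by simp
  show "x \<in> X \<Longrightarrow> (1, x) \<bullet> f = 0" using f by (simp add: inner_bv M_set_def)
qed

text \<open>
  A recession direction \<open>y\<close> can be added to a feasible point, and the equality holds at both ends.
\<close>

lemma F_set_recession:
  assumes f: "f \<in> F_set A0 A" and y: "\<forall>t\<in>simplex_T. 0 \<le> (0, y) \<bullet> av t"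
  shows "(0, y) \<bullet> f = 0"
proof -
  obtain x where x: "x \<in> X" using feasible_nonempty by blast
  have split: "(1, x + y) \<bullet> v = (1, x) \<bullet> v + (0, y) \<bullet> v" for v :: "real \<times> (real^'n)"
    by (simp add: inner_prod_def inner_add_left)
  have "x + y \<in> X" unfolding feasible_iff split using x y by (auto simp: feasible_iff)
  then show ?thesis using F_setD(2)[OF f x] F_setD(2)[OF f, of "x + y"] split[of f] by simp
qed

text \<open>
  Write \<open>t\<close> as a convex combination of vertices \<open>\<tau>\<close> with weights \<open>c \<tau>\<close> and expand
  \<open>a(t)\<close> bilinearly as the sum of \<open>c \<tau> t\<^sub>k b(k, \<tau>)\<close>. On the feasible set all the terms
  \<open>c \<tau> t\<^sub>k (D \<tau>)\<^sub>k\<close> are nonnegative with sum \<open>t \<bullet> (D t) = 0\<close>, so each index \<open>k\<close> with a nonzero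
  coefficient belongs to the set \<open>M\<close> of \<open>\<tau>\<close>.
\<close>

lemma a_vec_immobile_in_cone_F:
  assumes t: "t \<in> T_im A0 A"
  shows "av t \<in> fin_cone (F_set A0 A)"
proof -
  have "t \<in> convex hull V" using t by (simp add: convex_hull_vertices hull_inc)
  then obtain c where c: "\<And>\<tau>. \<tau> \<in> V \<Longrightarrow> 0 \<le> c \<tau>" and t_eq: "t = (\<Sum>\<tau>\<in>V. c \<tau> *\<^sub>R \<tau>)"
    unfolding convex_hull_finite[OF finite_vertices] by blast
  have tnn: "0 \<le> t $ k" for k using T_imD(2)[OF t] by (simp add: nonneg_vectors_def)
  have M: "k \<in> M_set A0 A \<tau>" if \<tau>: "\<tau> \<in> V" "c \<tau> > 0" and k: "t $ k > 0" for \<tau> k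
    unfolding M_set_def
  proof (intro CollectI ballI)
    fix x assume x: "x \<in> X"
    let ?D = "pencil A0 A x"
    note D = feasible_copositive[OF x]
    have V_T_im: "\<tau>' \<in> T_im A0 A" if "\<tau>' \<in> V" for \<tau>' using that vertices_subset_T_im by blast
    have "(\<Sum>\<tau>'\<in>V. c \<tau>' * (\<tau>' \<bullet> (?D *v t))) = t \<bullet> (?D *v t)"
      by (subst (2) t_eq) (simp add: inner_sum_left)
    also have "\<dots> = 0" by (rule T_imD(3)[OF t x])
    finally have "(\<Sum>\<tau>'\<in>V. c \<tau>' * (\<tau>' \<bullet> (?D *v t))) = 0" .
    moreover have "0 \<le> c \<tau>' * (\<tau>' \<bullet> (?D *v t))" if "\<tau>' \<in> V" for \<tau>'
      using c[OF that] T_imD(2)[OF V_T_im[OF that]]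
        copositive_gradient_nonneg[OF D T_imD(2)[OF t] T_imD(3)[OF t x]]
      by simp
    ultimately have "c \<tau> * (\<tau> \<bullet> (?D *v t)) = 0"
      using sum_nonneg_eq_0_iff[OF finite_vertices, of "\<lambda>\<tau>'. c \<tau>' * (\<tau>' \<bullet> (?D *v t))"] \<tau>(1)
      by simp
    then have "t \<bullet> (?D *v \<tau>) = 0"
      using \<tau>(2) symmetric_inner_commute[OF pencil_symmetric, of t x \<tau>] by simp
    then have "(\<Sum>i\<in>UNIV. t $ i * (?D *v \<tau>) $ i) = 0" by (simp add: inner_vec_def)
    moreover have "0 \<le> t $ i * (?D *v \<tau>) $ i" for i
    proof -
      have "0 \<le> (1, x) \<bullet> bv i \<tau>" using b_vec_valid[OF \<tau>(1)] x by (simp add: valid_ineqs_def)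
      then show ?thesis using tnn by (simp add: inner_bv inner_axis')
    qed
    ultimately have "t $ k * (?D *v \<tau>) $ k = 0" by (simp add: sum_nonneg_eq_0_iff)
    then show "axis k 1 \<bullet> (?D *v \<tau>) = 0" using k by (simp add: inner_axis')
  qed
  have "av t = (\<Sum>\<tau>\<in>V. c \<tau> *\<^sub>R coeff_vec A0 A t \<tau>)"
    unfolding a_vec_eq_coeff_vec
    by (subst (2) t_eq)
       (simp add: linear_sum[OF linear_coeff_vec_right] linear_scale[OF linear_coeff_vec_right])
  also have "\<dots> = (\<Sum>\<tau>\<in>V. \<Sum>k\<in>UNIV. (c \<tau> * t $ k) *\<^sub>R bv k \<tau>)"
    by (simp add: coeff_vec_eq_sum_b_vec scaleR_sum_right)
  also have "\<dots> \<in> fin_cone (F_set A0 A)"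
  proof (intro convex_cone_sum[OF convex_cone_fin_cone])
    fix \<tau> k assume \<tau>: "\<tau> \<in> V"
    show "(c \<tau> * t $ k) *\<^sub>R bv k \<tau> \<in> fin_cone (F_set A0 A)"
    proof (cases "c \<tau> > 0 \<and> t $ k > 0")
      case True
      then have "bv k \<tau> \<in> F_set A0 A" using M \<tau> unfolding F_set_def by blast
      then show ?thesis
        using c[OF \<tau>] tnn by (intro convex_cone_scaleR[OF convex_cone_fin_cone] fin_cone_inc) auto
    next
      case False
      then have "c \<tau> * t $ k = 0" using c[OF \<tau>] tnn[of k] by auto
      then show ?thesis
        by (simp only: scaleR_zero_left convex_cone_contains_0[OF convex_cone_fin_cone])
    qed
  qed
  finally show ?thesis .
qed

text \<open>
  Tightness at the relative interior point forces the tightness of every generator with positive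
  weight in a conic representation of \<open>z\<close>; tight generators are \<open>a(t)\<close> with \<open>t\<close> immobile.
\<close>

lemma cone_G_equalities_in_cone_F:
  assumes x: "x \<in> rel_interior X" and z: "z \<in> K" "(1, x) \<bullet> z = 0"
  shows "z \<in> fin_cone (F_set A0 A)"
proof -
  have xX: "x \<in> X" using x rel_interior_subset by blast
  obtain S c where S: "finite S" "S \<subseteq> G_set A0 A" "\<forall>v\<in>S. 0 \<le> c v"
    and z_eq: "z = (\<Sum>v\<in>S. c v *\<^sub>R v)"
    using z(1) unfolding fin_cone_def by blast
  have valid: "0 \<le> (1, x) \<bullet> v" if "v \<in> S" for v
    using that S(2) G_set_valid xX by (auto simp: valid_ineqs_def)
  have "(\<Sum>v\<in>S. c v * ((1, x) \<bullet> v)) = 0" using z(2) by (simp add: z_eq inner_sum_right)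
  then have zero: "c v * ((1, x) \<bullet> v) = 0" if "v \<in> S" for v
    using sum_nonneg_eq_0_iff[OF S(1), of "\<lambda>v. c v * ((1, x) \<bullet> v)"] valid S(3) that by simp
  show ?thesis
    unfolding z_eq
  proof (rule convex_cone_sum[OF convex_cone_fin_cone])
    fix v assume v: "v \<in> S"
    show "c v *\<^sub>R v \<in> fin_cone (F_set A0 A)"
    proof (cases "c v = 0")
      case True
      then show ?thesis by (simp add: convex_cone_contains_0[OF convex_cone_fin_cone])
    next
      case False
      then have tight: "(1, x) \<bullet> v = 0" using zero[OF v] by simp
      then have "v \<noteq> (1, 0)" by auto
      then obtain t where t: "v = av t" "t \<in> simplex_T" using v S(2) by (auto simp: G_set_def)
      have "av t \<in> valid_ineqs" using v S(2) G_set_valid t by blast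
      then have "(1, y) \<bullet> av t = 0" if "y \<in> X" for y
        using valid_ineq_equality[OF x _ _ that] tight t by blast
      then have "t \<in> T_im A0 A" using t by (simp add: T_im_def inner_av)
      then have "v \<in> fin_cone (F_set A0 A)" using a_vec_immobile_in_cone_F t by simp
      then show ?thesis using S(3) v by (intro convex_cone_scaleR[OF convex_cone_fin_cone]) auto
    qed
  qed
qed

lemma rel_interior_point: obtains x where "x \<in> rel_interior X" "x \<in> X"
  using rel_interior_eq_empty[OF convex_feasible] feasible_nonempty rel_interior_subset by blast

text \<open>
  Both signs of an equality on \<open>X\<close> are valid inequalities, hence in the cone of \<open>G\<close>, hence in the
  cone of \<open>F\<close>.
\<close>

lemma subspace_cone_F:
  assumes sub: "valid_ineqs \<subseteq> K"
  shows "subspace (fin_cone (F_set A0 A))"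
proof -
  obtain x where x: "x \<in> rel_interior X" "x \<in> X" by (rule rel_interior_point)
  have "F_set A0 A \<subseteq> uminus -` fin_cone (F_set A0 A)"
  proof
    fix f assume f: "f \<in> F_set A0 A"
    have "- f \<in> valid_ineqs" using F_setD(2)[OF f] by (simp add: valid_ineqs_def)
    then have "- f \<in> fin_cone (F_set A0 A)"
      using sub F_setD(2)[OF f x(2)] by (intro cone_G_equalities_in_cone_F[OF x(1)]) auto
    then show "f \<in> uminus -` fin_cone (F_set A0 A)" by simp
  qed
  moreover have "convex_cone (uminus -` fin_cone (F_set A0 A))"
    unfolding convex_cone_iff
  proof (intro conjI ballI allI impI; unfold vimage_eq)
    fix u v assume "- u \<in> fin_cone (F_set A0 A)" "- v \<in> fin_cone (F_set A0 A)"
    then have "- u + - v \<in> fin_cone (F_set A0 A)" by (rule convex_cone_add[OF convex_cone_fin_cone])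
    then show "- (u + v) \<in> fin_cone (F_set A0 A)" by simp
  next
    fix u and r :: real assume u: "- u \<in> fin_cone (F_set A0 A)" "0 \<le> r"
    then have "r *\<^sub>R (- u) \<in> fin_cone (F_set A0 A)"
      by (intro convex_cone_scaleR[OF convex_cone_fin_cone])
    then show "- (r *\<^sub>R u) \<in> fin_cone (F_set A0 A)" by simp
  qed (simp add: convex_cone_contains_0[OF convex_cone_fin_cone])
  ultimately have neg: "fin_cone (F_set A0 A) \<subseteq> uminus -` fin_cone (F_set A0 A)"
    by (rule fin_cone_minimal)
  show ?thesis
    unfolding subspace_def
  proof (intro conjI ballI allI)
    fix z and r :: real assume z: "z \<in> fin_cone (F_set A0 A)"
    show "r *\<^sub>R z \<in> fin_cone (F_set A0 A)"
    proof (cases "0 \<le> r")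
      case True
      then show ?thesis using z by (rule convex_cone_scaleR[OF convex_cone_fin_cone])
    next
      case False
      have "- z \<in> fin_cone (F_set A0 A)" using z neg by auto
      then have "(- r) *\<^sub>R (- z) \<in> fin_cone (F_set A0 A)"
        using False by (intro convex_cone_scaleR[OF convex_cone_fin_cone]) auto
      then show ?thesis by simp
    qed
  qed (simp_all add: convex_cone_contains_0[OF convex_cone_fin_cone]
      convex_cone_add[OF convex_cone_fin_cone])
qed

subsection \<open>The reduced system defined by \<open>F\<close> and \<open>W\<close>\<close>

lemma vertex_index_cases:
  assumes \<tau>: "\<tau> \<in> V"
  shows "k \<in> M_set A0 A \<tau> \<or> k \<in> N_set A0 A \<tau> \<or> (\<forall>x\<in>X. 0 < (1, x) \<bullet> bv k \<tau>)"
proof (cases "k \<in> N_star A0 A \<tau>")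
  case True
  then show ?thesis by (simp add: N_set_def)
next
  case False
  have "0 \<le> (1, x) \<bullet> bv k \<tau>" if "x \<in> X" for x
    using b_vec_valid[OF \<tau>] that by (simp add: valid_ineqs_def)
  moreover have "(1, x) \<bullet> bv k \<tau> \<noteq> 0" if "x \<in> X" for x
    using False that unfolding N_star_def inner_bv by blast
  ultimately have "0 < (1, x) \<bullet> bv k \<tau>" if "x \<in> X" for x
    using that unfolding less_le by metis
  then show ?thesis by blast
qed

lemma feasible_if_vertex_nonneg:
  assumes "\<And>t. t \<in> Omega A0 A \<Longrightarrow> 0 \<le> (1, x) \<bullet> av t"
    and "\<And>\<tau> k. \<tau> \<in> V \<Longrightarrow> 0 \<le> (1, x) \<bullet> bv k \<tau>"
  shows "x \<in> X"
  unfolding feasible_iff_nonneg inner_av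
  using copositivity_test_on_Omega_and_vertices[OF pencil_symmetric] assms
  unfolding inner_av inner_bv by blast

text \<open>
  The indices outside \<open>N\<^sub>*\<close> give constraints that are strict on \<open>X\<close>. If a solution \<open>x\<close> of the
  reduced system violated some of them, then moving from a feasible \<open>y\<close> towards \<open>x\<close> up to the last
  point where none is violated would give a feasible point with an active one.
\<close>

lemma feasible_if_reduced_system:
  assumes \<Omega>: "\<And>t. t \<in> Omega A0 A \<Longrightarrow> 0 \<le> (1, x) \<bullet> av t"
    and F: "\<And>f. f \<in> F_set A0 A \<Longrightarrow> (1, x) \<bullet> f = 0"
    and N: "\<And>\<tau> k. \<tau> \<in> V \<Longrightarrow> k \<in> N_set A0 A \<tau> \<Longrightarrow> 0 \<le> (1, x) \<bullet> bv k \<tau>"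
  shows "x \<in> X"
proof (rule ccontr)
  assume notX: "x \<notin> X"
  obtain y where y: "y \<in> X" using feasible_nonempty by blast
  define g where "g = (\<lambda>z (\<tau>, k). (1::real, z::real^'n) \<bullet> bv k \<tau>)"
  define B where "B = {(\<tau>, k). \<tau> \<in> V \<and> g x (\<tau>, k) < 0}"
  have gy: "0 \<le> g y (\<tau>, k)" if "\<tau> \<in> V" for \<tau> k
    using b_vec_valid[OF that] y by (simp add: valid_ineqs_def g_def)
  have gx: "0 \<le> g x (\<tau>, k)" if "\<tau> \<in> V" "\<not> (\<forall>z\<in>X. 0 < g z (\<tau>, k))" for \<tau> k
  proof -
    have "\<not> (\<forall>z\<in>X. 0 < (1, z) \<bullet> bv k \<tau>)" using that(2) by (simp add: g_def)
    then consider "k \<in> M_set A0 A \<tau>" | "k \<in> N_set A0 A \<tau>"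
      using vertex_index_cases[OF \<open>\<tau> \<in> V\<close>] by metis
    then show ?thesis
    proof cases
      case 1
      then have "bv k \<tau> \<in> F_set A0 A" using that(1) unfolding F_set_def by blast
      then show ?thesis using F by (simp add: g_def)
    qed (use N that(1) in \<open>simp add: g_def\<close>)
  qed
  have B_pos: "0 < g z i" if "i \<in> B" "z \<in> X" for i z
    using that gx unfolding B_def by fastforce
  have "B \<subseteq> V \<times> UNIV" by (auto simp: B_def)
  then have finB: "finite B" by (rule finite_subset) (simp add: finite_vertices)
  have "B \<noteq> {}"
  proof
    assume "B = {}"
    then have "0 \<le> (1, x) \<bullet> bv k \<tau>" if "\<tau> \<in> V" for \<tau> k
      using that by (auto simp: B_def g_def not_less)
    then show False using feasible_if_vertex_nonneg[OF \<Omega>] notX by blast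
  qed
  \<comment> \<open>the point where the segment from \<open>y\<close> to \<open>x\<close> first meets the boundary of a violated
      constraint\<close>
  define r where "r i = g y i / (g y i - g x i)" for i
  define q where "q = Min (r ` B)"
  have "q \<in> r ` B" unfolding q_def using finB \<open>B \<noteq> {}\<close> by (intro Min_in) auto
  then obtain i where i: "i \<in> B" "q = r i" by blast
  have gneg: "g x j < 0" if "j \<in> B" for j using that by (auto simp: B_def)
  have q: "0 \<le> q" "q \<le> 1"
    using B_pos[OF i(1) y] gneg[OF i(1)] by (auto simp: i(2) r_def)
  define z where "z = (1 - q) *\<^sub>R y + q *\<^sub>R x"
  have affine: "(1, z) \<bullet> v = (1 - q) * ((1, y) \<bullet> v) + q * ((1, x) \<bullet> v)" for v :: "real \<times> (real^'n)"
    by (simp add: z_def inner_prod_def inner_add_left algebra_simps)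
  have gz: "g z j = (1 - q) * g y j + q * g x j" for j
    by (cases j) (simp add: g_def affine)
  have "z \<in> X"
  proof (rule feasible_if_vertex_nonneg)
    fix t assume t: "t \<in> Omega A0 A"
    then have "0 \<le> (1, y) \<bullet> av t" using y by (simp add: feasible_iff Omega_iff)
    then show "0 \<le> (1, z) \<bullet> av t" using q \<Omega>[OF t] by (simp add: affine)
  next
    fix \<tau> k assume \<tau>: "\<tau> \<in> V"
    have "0 \<le> g z (\<tau>, k)"
    proof (cases "(\<tau>, k) \<in> B")
      case True
      let ?y = "g y (\<tau>, k)" and ?x = "g x (\<tau>, k)"
      have "q \<le> r (\<tau>, k)" unfolding q_def using True finB by (intro Min_le) auto
      then have "q * (?y - ?x) \<le> ?y"
        using gneg[OF True] gy[OF \<tau>, of k] by (simp add: r_def pos_le_divide_eq)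
      then show ?thesis by (simp add: gz algebra_simps)
    next
      case False
      then have "0 \<le> g x (\<tau>, k)" using \<tau> by (auto simp: B_def)
      then show ?thesis using q gy[OF \<tau>, of k] by (simp add: gz)
    qed
    then show "0 \<le> (1, z) \<bullet> bv k \<tau>" by (simp add: g_def)
  qed
  then have "0 < g z i" using B_pos i(1) by blast
  moreover have "q * (g y i - g x i) = g y i"
    using B_pos[OF i(1) y] gneg[OF i(1)] by (simp add: i(2) r_def)
  then have "g z i = 0" by (simp add: gz algebra_simps)
  ultimately show False by simp
qed

lemma W_tilde_valid: "W_tilde A0 A \<subseteq> valid_ineqs"
proof
  fix w assume "w \<in> W_tilde A0 A"
  then consider "w = (1, 0)" | t where "t \<in> Omega A0 A" "w = av t" | k \<tau> where "\<tau> \<in> V" "w = bv k \<tau>"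
    unfolding W_tilde_def by blast
  then show "w \<in> valid_ineqs"
    by cases (use b_vec_valid in \<open>auto simp: valid_ineqs_def feasible_iff Omega_iff\<close>)
qed

text \<open>
  The polar form of \<open>feasible_if_reduced_system\<close>; it also covers the functionals whose leading
  coordinate is zero.
\<close>

lemma polar_F_W_tilde_subset_polar_G:
  assumes F: "\<And>f. f \<in> F_set A0 A \<Longrightarrow> y \<bullet> f = 0"
    and W: "\<And>w. w \<in> W_tilde A0 A \<Longrightarrow> 0 \<le> y \<bullet> w"
    and t: "t \<in> simplex_T"
  shows "0 \<le> y \<bullet> av t"
proof -
  \<comment> \<open>the equations given by \<open>F\<close> as pairs of opposite inequalities\<close>
  let ?S = "F_set A0 A \<union> uminus ` F_set A0 A \<union> W_tilde A0 A"
  obtain x where x: "x \<in> X" using feasible_nonempty by blast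
  show ?thesis
  proof (rule nonneg_by_homogenization[of ?S x "av t"])
    show "(1, 0) \<in> ?S" by (simp add: W_tilde_def)
    show "\<forall>s\<in>?S. 0 \<le> (1, x) \<bullet> s"
      using F_setD(2)[OF _ x] W_tilde_valid x
      by (auto simp: valid_ineqs_def inner_minus_right simp del: inner_Pair uminus_Pair)
    show "\<forall>s\<in>?S. 0 \<le> y \<bullet> s"
      using F W by (auto simp: inner_minus_right simp del: uminus_Pair)
  next
    fix v assume v: "\<forall>s\<in>?S. 0 \<le> (1, v) \<bullet> s"
    have "v \<in> X"
    proof (rule feasible_if_reduced_system)
      fix f assume "f \<in> F_set A0 A"
      then have "0 \<le> (1, v) \<bullet> f" "0 \<le> (1, v) \<bullet> (- f)" using v by blast+
      then show "(1, v) \<bullet> f = 0" unfolding inner_minus_right by linarith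
    next
      fix t assume "t \<in> Omega A0 A"
      then have "av t \<in> W_tilde A0 A" unfolding W_tilde_def by blast
      then show "0 \<le> (1, v) \<bullet> av t" using v by blast
    next
      fix \<tau> k assume "\<tau> \<in> V" "k \<in> N_set A0 A \<tau>"
      then have "bv k \<tau> \<in> W_tilde A0 A" unfolding W_tilde_def by blast
      then show "0 \<le> (1, v) \<bullet> bv k \<tau>" using v by blast
    qed
    then show "0 \<le> (1, v) \<bullet> av t" using t by (simp add: feasible_iff)
  qed
qed

subsection \<open>The projected part \<open>W\<close>\<close>

lemma W_set_projection:
  obtains p where "linear p" "W_set A0 A = p ` W_tilde A0 A" "\<forall>v. v - p v \<in> span (F_set A0 A)"
proof (rule orth_projector[OF subspace_orthogonal_comp[of "span (F_set A0 A)"]])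
  fix p assume p: "linear p" "\<And>v. v - p v \<in> (span (F_set A0 A))\<^sup>\<bottom>\<^sup>\<bottom>"
    "\<And>B. orth_projection B ((span (F_set A0 A))\<^sup>\<bottom>) = p ` B"
  show thesis
  proof (rule that)
    show "linear p" by (rule p(1))
    show "W_set A0 A = p ` W_tilde A0 A" unfolding W_set_def by (rule p(3))
    show "\<forall>v. v - p v \<in> span (F_set A0 A)"
      using p(2) by (simp add: orthogonal_comp_self)
  qed
qed

lemma compact_W: "compact (W_set A0 A)"
proof -
  obtain p where p: "linear p" "W_set A0 A = p ` W_tilde A0 A"
    and "\<forall>v. v - p v \<in> span (F_set A0 A)"
    by (rule W_set_projection)
  have "continuous_on (Omega A0 A) (\<lambda>t. t \<bullet> (D *v t))" for D :: "real^'p^'p"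
    by (rule continuous_on_inner[OF continuous_on_id])
       (rule linear_continuous_on[OF matrix_vector_mul_bounded_linear])
  then have "continuous_on (Omega A0 A) av"
    unfolding a_vec_def by (intro continuous_on_Pair continuous_on_vec_lambda)
  then have \<Omega>: "compact (av ` Omega A0 A)" by (rule compact_continuous_image[OF _ compact_Omega])
  have N: "finite {bv k \<tau> | k \<tau>. \<tau> \<in> V \<and> k \<in> N_set A0 A \<tau>}"
  proof (rule finite_subset)
    show "{bv k \<tau> | k \<tau>. \<tau> \<in> V \<and> k \<in> N_set A0 A \<tau>} \<subseteq> (\<Union>\<tau>\<in>V. range (\<lambda>k. bv k \<tau>))" by auto
  qed (simp add: finite_vertices)
  have "compact (W_tilde A0 A)"
    unfolding W_tilde_def
    by (intro compact_Un \<Omega> finite_imp_compact[OF N] compact_insert compact_empty)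
  moreover have "continuous_on (W_tilde A0 A) p"
    using p(1) unfolding linear_conv_bounded_linear by (rule linear_continuous_on)
  ultimately show ?thesis unfolding p(2) by (rule compact_continuous_image[rotated])
qed

lemma W_set_orthogonal: "W_set A0 A \<subseteq> (span (F_set A0 A))\<^sup>\<bottom>"
  by (auto simp: W_set_def orth_projection_def)

text \<open>
  The functional \<open>(1, x)\<close> vanishes on the span of \<open>F\<close>, so it does not see the projection. Each
  unprojected generator is a valid inequality that is not an equality on all of \<open>X\<close>, hence strict
  at \<open>x\<close>.
\<close>

lemma W_set_strictly_positive:
  assumes x: "x \<in> rel_interior X" and w: "w \<in> W_set A0 A"
  shows "0 < (1, x) \<bullet> w"
proof -
  have xX: "x \<in> X" using x rel_interior_subset by blast
  obtain p where "linear p"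
    and p: "W_set A0 A = p ` W_tilde A0 A" "\<forall>v. v - p v \<in> span (F_set A0 A)"
    by (rule W_set_projection)
  then obtain v where v: "v \<in> W_tilde A0 A" "w = p v" using w by blast
  have "span (F_set A0 A) \<subseteq> {u. (1, x) \<bullet> u = 0}"
    using F_setD(2) xX by (intro span_minimal subspace_hyperplane) auto
  then have eq: "(1, x) \<bullet> w = (1, x) \<bullet> v" using p(2)[THEN spec, of v] v(2) by (auto simp: inner_diff_right)
  have valid: "v \<in> valid_ineqs" using v(1) W_tilde_valid by blast
  have "v = (1, 0) \<or> (\<exists>y\<in>X. (1, y) \<bullet> v \<noteq> 0)"
    using v(1) unfolding W_tilde_def
  proof (elim UnE)
    assume "v \<in> av ` Omega A0 A"
    then obtain t where t: "v = av t" "t \<in> Omega A0 A" by blast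
    then have "t \<in> simplex_T" "t \<notin> T_im A0 A" using Omega_disjoint_T_im by (auto simp: Omega_iff)
    then show ?thesis unfolding t(1) T_im_def inner_av by blast
  next
    assume "v \<in> {bv k \<tau> | k \<tau>. \<tau> \<in> V \<and> k \<in> N_set A0 A \<tau>}"
    then obtain k \<tau> where "v = bv k \<tau>" "k \<notin> M_set A0 A \<tau>" unfolding N_set_def by blast
    then show ?thesis unfolding M_set_def inner_bv[symmetric] by blast
  qed simp
  then have "(1, x) \<bullet> v \<noteq> 0"
  proof
    assume "\<exists>y\<in>X. (1, y) \<bullet> v \<noteq> 0"
    then show ?thesis using valid_ineq_equality[OF x valid] by blast
  qed simp
  moreover have "0 \<le> (1, x) \<bullet> v" using valid xX unfolding valid_ineqs_def by blast
  ultimately show ?thesis using eq by simp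
qed

text \<open>
  The projection changes a generator only by an element of the span of \<open>F\<close>, that is, by an equality
  on \<open>X\<close>; so projected generators are still valid inequalities.
\<close>

lemma W_set_subset_cone_G:
  assumes sub: "valid_ineqs \<subseteq> K"
  shows "W_set A0 A \<subseteq> K"
proof
  fix w assume "w \<in> W_set A0 A"
  obtain p where "linear p"
    and p: "W_set A0 A = p ` W_tilde A0 A" "\<forall>v. v - p v \<in> span (F_set A0 A)"
    by (rule W_set_projection)
  then obtain v where v: "v \<in> W_tilde A0 A" "w = p v" using \<open>w \<in> W_set A0 A\<close> by blast
  have "v \<in> valid_ineqs" using v(1) W_tilde_valid by blast
  moreover have "p v - v \<in> valid_ineqs"
  proof -
    have "span (F_set A0 A) \<subseteq> {u. (1, x) \<bullet> u = 0}" if "x \<in> X" for x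
      using F_setD(2) that by (intro span_minimal subspace_hyperplane) auto
    then have "(1, x) \<bullet> (v - p v) = 0" if "x \<in> X" for x using p(2)[THEN spec, of v] that by blast
    then show ?thesis by (simp add: valid_ineqs_def inner_diff_right)
  qed
  ultimately have "v + (p v - v) \<in> valid_ineqs" by (rule convex_cone_add[OF convex_cone_valid_ineqs])
  then show "w \<in> K" using sub v(2) by auto
qed

lemma cone_F_W_eq_cone_G:
  assumes sub: "valid_ineqs \<subseteq> K"
  shows "K = fin_cone (F_set A0 A \<union> W_set A0 A)"
proof
  let ?C = "fin_cone (F_set A0 A \<union> W_set A0 A)"
  show "?C \<subseteq> K"
    using W_set_subset_cone_G[OF sub] F_setD(1) sub convex_cone_fin_cone
    by (intro fin_cone_minimal) auto
  have F: "subspace (fin_cone (F_set A0 A))" by (rule subspace_cone_F[OF sub])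
  obtain x where x: "x \<in> rel_interior X" by (rule rel_interior_point)
  have closed: "closed ?C"
    using closed_fin_cone_compact[OF compact_W] W_set_strictly_positive[OF x]
    by (blast intro: closed_fin_cone_subspace_Un_orthogonal[OF F _ W_set_orthogonal])
  show "K \<subseteq> ?C"
  proof (rule fin_cone_minimal[OF _ convex_cone_fin_cone], rule subsetI)
    fix z assume z: "z \<in> G_set A0 A"
    show "z \<in> ?C"
    proof (rule mem_fin_cone_of_polar[OF closed])
      fix y assume y: "\<forall>b\<in>F_set A0 A \<union> W_set A0 A. 0 \<le> y \<bullet> b"
      have "fin_cone (F_set A0 A) \<subseteq> {v. 0 \<le> y \<bullet> v}"
        using y by (intro fin_cone_minimal convex_cone_halfspace_ge) auto
      then have Fnn: "0 \<le> y \<bullet> v" if "v \<in> span (F_set A0 A)" for v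
        using that fin_cone_eq_span[OF F] by blast
      have F0: "y \<bullet> v = 0" if v: "v \<in> span (F_set A0 A)" for v
        using Fnn[OF v] Fnn[OF span_neg[OF v]] by simp
      obtain p where "linear p"
    and p: "W_set A0 A = p ` W_tilde A0 A" "\<forall>v. v - p v \<in> span (F_set A0 A)"
        by (rule W_set_projection)
      have W0: "0 \<le> y \<bullet> w" if "w \<in> W_tilde A0 A" for w
      proof -
        have "0 \<le> y \<bullet> p w" using that y p(1) by blast
        then show ?thesis using F0[OF p(2)[THEN spec, of w]] by (simp add: inner_diff_right)
      qed
      show "0 \<le> y \<bullet> z"
      proof (cases "z = (1, 0)")
        case True
        then show ?thesis using W0 by (simp add: W_tilde_def)
      next
        case False
        then obtain t where "t \<in> simplex_T" "z = av t" using z by (auto simp: G_set_def)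
        then show ?thesis using polar_F_W_tilde_subset_polar_G[OF F0[OF span_base] W0] by blast
      qed
    qed
  qed
qed

text \<open>
  Farkas lemma for a closed cone of coefficients.
\<close>

lemma closed_cone_G_imp_valid_in_cone:
  assumes "closed K"
  shows "valid_ineqs \<subseteq> K"
proof (rule subsetI, rule mem_fin_cone_of_polar[OF assms])
  fix z y assume z: "z \<in> valid_ineqs" and y: "\<forall>b\<in>G_set A0 A. 0 \<le> y \<bullet> b"
  obtain x where x: "x \<in> X" using feasible_nonempty by blast
  show "0 \<le> y \<bullet> z"
  proof (rule nonneg_by_homogenization[of "G_set A0 A" x z])
    show "(1, 0) \<in> G_set A0 A" by (simp add: G_set_def)
    show "\<forall>s\<in>G_set A0 A. 0 \<le> (1, x) \<bullet> s" using G_set_valid x by (auto simp: valid_ineqs_def)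
  next
    fix v assume "\<forall>s\<in>G_set A0 A. 0 \<le> (1, v) \<bullet> s"
    then have "v \<in> X" by (simp add: feasible_iff G_set_def)
    then show "0 \<le> (1, v) \<bullet> z" using z by (simp add: valid_ineqs_def)
  qed (rule y)
qed

end

theorem theorem3:
  fixes A0 :: "real^'p^'p" and A :: "'n::finite \<Rightarrow> real^'p^'p"
  assumes p: "CARD('p) > 1"
    and sym0: "A0 \<in> symmetric_matrices"
    and sym: "\<And>m. A m \<in> symmetric_matrices"
    and cons: "consistent A0 A"
    and im: "T_im A0 A \<noteq> {}"
  shows "(uniform_LP_duality A0 A \<longleftrightarrow>
            fin_cone (G_set A0 A) = fin_cone (F_set A0 A \<union> W_set A0 A)
            \<and> (finite (F_set A0 A) \<and> subspace (fin_cone (F_set A0 A))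
                \<and> fin_cone (F_set A0 A) \<subseteq> fin_cone (G_set A0 A))
            \<and> (compact (W_set A0 A) \<and>
                (\<exists>xbar::real^'n. (\<forall>(s0, s)\<in>F_set A0 A. s0 + s \<bullet> xbar = 0)
                   \<and> (\<forall>(t0, t)\<in>W_set A0 A. t0 + t \<bullet> xbar > 0))))
       \<and> (\<forall>(s0, s)\<in>F_set A0 A.
            (\<forall>x. (\<forall>t\<in>simplex_T. (1, x) \<bullet> a_vec A0 A t \<ge> 0) \<longrightarrow> s \<bullet> x = - s0)
            \<and> (\<forall>x. (\<forall>t\<in>simplex_T. (0, x) \<bullet> a_vec A0 A t \<ge> 0) \<longrightarrow> s \<bullet> x = 0))
       \<and> (\<forall>(s0, s)\<in>F_set A0 A. \<forall>(t0, t)\<in>W_set A0 A. s \<bullet> t + s0 * t0 = 0)"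
proof -
  interpret copositive_system A0 A
    by unfold_locales (use sym0 sym cons im in \<open>auto simp: consistent_def\<close>)
  let ?F = "F_set A0 A" and ?W = "W_set A0 A"
  let ?decomposition = "K = fin_cone (?F \<union> ?W)
    \<and> (finite ?F \<and> subspace (fin_cone ?F) \<and> fin_cone ?F \<subseteq> K)
    \<and> (compact ?W \<and> (\<exists>xbar::real^'n. (\<forall>(s0, s)\<in>?F. s0 + s \<bullet> xbar = 0)
         \<and> (\<forall>(t0, t)\<in>?W. t0 + t \<bullet> xbar > 0)))"
  have "?decomposition" if "uniform_LP_duality A0 A"
  proof -
    have sub: "valid_ineqs \<subseteq> K" using uniform_LP_duality_imp_valid_in_cone[OF that] by blast
    obtain x where x: "x \<in> rel_interior X" "x \<in> X" by (rule rel_interior_point)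
    have "fin_cone ?F \<subseteq> K"
      using F_setD(1) sub convex_cone_fin_cone by (intro fin_cone_minimal) auto
    moreover have "\<forall>(s0, s)\<in>?F. s0 + s \<bullet> x = 0"
      using F_setD(2)[OF _ x(2)] by (auto simp: inner_commute)
    moreover have "\<forall>(t0, t)\<in>?W. t0 + t \<bullet> x > 0"
      using W_set_strictly_positive[OF x(1)] by (auto simp: inner_commute)
    ultimately show ?thesis
      using cone_F_W_eq_cone_G[OF sub] finite_F subspace_cone_F[OF sub] compact_W by blast
  qed
  moreover have "uniform_LP_duality A0 A" if dec: "?decomposition"
  proof -
    obtain xbar :: "real^'n" where "\<forall>(t0, t)\<in>?W. t0 + t \<bullet> xbar > 0" using dec by blast
    then have "\<forall>w\<in>?W. 0 < (1, xbar) \<bullet> w" by (auto simp: inner_commute)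
    then have "closed (fin_cone ?W)" by (rule closed_fin_cone_compact[OF compact_W])
    then have "closed (fin_cone (?F \<union> ?W))"
      using dec W_set_orthogonal by (intro closed_fin_cone_subspace_Un_orthogonal) auto
    then have "closed K" using dec by simp
    then show ?thesis
      by (intro valid_in_cone_imp_uniform_LP_duality closed_cone_G_imp_valid_in_cone)
  qed
  ultimately have "uniform_LP_duality A0 A \<longleftrightarrow> ?decomposition" by (rule iffI)
  moreover have "\<forall>(s0, s)\<in>?F.
      (\<forall>x. (\<forall>t\<in>simplex_T. (1, x) \<bullet> av t \<ge> 0) \<longrightarrow> s \<bullet> x = - s0)
      \<and> (\<forall>x. (\<forall>t\<in>simplex_T. (0, x) \<bullet> av t \<ge> 0) \<longrightarrow> s \<bullet> x = 0)"
  proof (intro ballI, clarify, intro conjI allI impI)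
    fix s0 s x assume f: "(s0, s) \<in> ?F"
    {
      assume "\<forall>t\<in>simplex_T. (1, x) \<bullet> av t \<ge> 0"
      then have "x \<in> X" by (simp add: feasible_iff)
      then have "(1, x) \<bullet> (s0, s) = 0" by (rule F_setD(2)[OF f])
      then show "s \<bullet> x = - s0" by (simp add: inner_commute)
    next
      assume "\<forall>t\<in>simplex_T. (0, x) \<bullet> av t \<ge> 0"
      then have "(0, x) \<bullet> (s0, s) = 0" by (rule F_set_recession[OF f])
      then show "s \<bullet> x = 0" by (simp add: inner_commute)
    }
  qed
  moreover have "\<forall>(s0, s)\<in>?F. \<forall>(t0, t)\<in>?W. s \<bullet> t + s0 * t0 = 0"
  proof (intro ballI, clarify)
    fix s0 s t0 t assume "(s0, s) \<in> ?F" "(t0, t) \<in> ?W"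
    then have "orthogonal (s0, s) (t0, t)"
      using W_set_orthogonal span_base unfolding orthogonal_comp_def by blast
    then show "s \<bullet> t + s0 * t0 = 0" by (simp add: orthogonal_def add.commute)
  qed
  ultimately show ?thesis by (intro conjI)
qed

end
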